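(* For all $n\ge1$ and $0\le j\le n$: (1) the polynomial $\sum_{\pi\in C_l\wr\mathfrak{S}_n,\ \mathrm{fix}(\pi)=j}t^{\mathrm{fexc}(\pi)}q^{(\mathrm{maj}-\mathrm{exc})\pi}$ is $t$-symmetric and $t$-unimodal with center of symmetry $\frac{l(n-j)}{2}$; (2) $A_n^{(l)}(t,q)=\sum_{\pi\in C_l\wr\mathfrak{S}_n}t^{\mathrm{fexc}(\pi)}q^{(\mathrm{maj}-\mathrm{exc})\pi}$ is $t$-symmetric and $t$-unimodal with center of symmetry $\frac{ln-1}{2}$. Here coefficients in $\mathbb{Q}[q]$ are ordered by $f\le_q g$ iff $g-f$ has nonnegative coefficients.
   Context: $C_l\wr\mathfrak{S}_n$ is the set of words $\pi=\pi_1\cdots\pi_n$ with $\pi_i=|\pi_i|^{\epsilon_i}$, $\epsilon_i\in\{0,\dots,l-1\}$, $|\pi_1|\cdots|\pi_n|\in\mathfrak{S}_n$. Order colored integers by $u^a<v^b$ iff $a>b$, or $a=b$ and $u<v$. $\mathrm{maj}(\pi)=\sum\{i\in[n-1]:\pi_i>\pi_{i+1}\}$; $\mathrm{exc}(\pi)$ is the number of $i$ with $\epsilon_i=0$ and $|\pi_i|>i$; $\mathrm{fexc}(\pi)=l\,\mathrm{exc}(\pi)+\sum_i\epsilon_i$; $\mathrm{fix}(\pi)=|\{i:\pi_i=i^0\}|$. A nonzero polynomial $\sum_{i=r}^sa_it^i$ ($a_r,a_s\ne0$) is $t$-symmetric with center $\frac{r+s}2$ if $a_{r+k}=a_{s-k}$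 for all $k$, and $t$-unimodal if $a_r\le_q\cdots\le_q a_{\lfloor(r+s)/2\rfloor}$ and $a_{\lfloor(r+s+1)/2\rfloor}\ge_q\cdots\ge_q a_s$.
   Formalization: Part (1) excludes the case l = 1, j = n−1: no permutation has exactly n−1 fixed points, so the polynomial is zero there and has no center of symmetry under the definition, which requires a nonzero polynomial. *)

theory Defs
  imports Complex_Main "HOL-Combinatorics.Permutations"
begin

text \<open>A colored permutation in C_l wr S_n is encoded as a pair (sigma, eps):
  sigma permutes {1..n} (sigma i = |pi_i|), eps i is the color epsilon_i of
  position i, with eps i < l for all i and eps i = 0 outside {1..n}.\<close>

definition colored_perms :: "nat \<Rightarrow> nat \<Rightarrow> ((nat \<Rightarrow> nat) \<times> (nat \<Rightarrow> nat)) set" where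
  "colored_perms l n = {(\<sigma>, \<epsilon>). \<sigma> permutes {1..n} \<and> (\<forall>i. \<epsilon> i < l) \<and> (\<forall>i. i \<notin> {1..n} \<longrightarrow> \<epsilon> i = 0)}"

definition col_less :: "nat \<times> nat \<Rightarrow> nat \<times> nat \<Rightarrow> bool" where
  "col_less x y = (snd x > snd y \<or> (snd x = snd y \<and> fst x < fst y))"

definition cmaj :: "nat \<Rightarrow> (nat \<Rightarrow> nat) \<times> (nat \<Rightarrow> nat) \<Rightarrow> nat" where
  "cmaj n p = (\<Sum>i \<in> {i \<in> {1..n-1}. col_less (fst p (i+1), snd p (i+1)) (fst p i, snd p i)}. i)"

definition cexc :: "nat \<Rightarrow> (nat \<Rightarrow> nat) \<times> (nat \<Rightarrow> nat) \<Rightarrow> nat" where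
  "cexc n p = card {i \<in> {1..n}. snd p i = 0 \<and> fst p i > i}"

definition cfexc :: "nat \<Rightarrow> nat \<Rightarrow> (nat \<Rightarrow> nat) \<times> (nat \<Rightarrow> nat) \<Rightarrow> nat" where
  "cfexc l n p = l * cexc n p + (\<Sum>i=1..n. snd p i)"

definition cfix :: "nat \<Rightarrow> (nat \<Rightarrow> nat) \<times> (nat \<Rightarrow> nat) \<Rightarrow> nat" where
  "cfix n p = card {i \<in> {1..n}. fst p i = i \<and> snd p i = 0}"

text \<open>A polynomial in t with coefficients that are (Laurent) polynomials in q is
  represented by its coefficient function: a i k = coefficient of t^i q^k.
  (Exponents k of q are taken in int, so no truncation of maj - exc occurs.)\<close>

definition q_le :: "(int \<Rightarrow> int) \<Rightarrow> (int \<Rightarrow> int) \<Rightarrow> bool" where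
  "q_le f g = (\<forall>k. f k \<le> g k)"

definition t_support :: "(nat \<Rightarrow> int \<Rightarrow> int) \<Rightarrow> nat set" where
  "t_support a = {i. a i \<noteq> (\<lambda>_. 0)}"

definition t_symmetric_center :: "(nat \<Rightarrow> int \<Rightarrow> int) \<Rightarrow> real \<Rightarrow> bool" where
  "t_symmetric_center a c =
    (t_support a \<noteq> {} \<and> finite (t_support a) \<and>
     (let r = Min (t_support a); s = Max (t_support a) in
        (\<forall>k. k \<le> s - r \<longrightarrow> a (r + k) = a (s - k)) \<and> c = (real r + real s) / 2))"

definition t_unimodal :: "(nat \<Rightarrow> int \<Rightarrow> int) \<Rightarrow> bool" where
  "t_unimodal a =
    (t_support a \<noteq> {} \<and> finite (t_support a) \<and>
     (let r = Min (t_support a); s = Max (t_support a) in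
        (\<forall>i. r \<le> i \<and> i < (r + s) div 2 \<longrightarrow> q_le (a i) (a (i + 1))) \<and>
        (\<forall>i. (r + s + 1) div 2 \<le> i \<and> i < s \<longrightarrow> q_le (a (i + 1)) (a i))))"

definition fix_coeff :: "nat \<Rightarrow> nat \<Rightarrow> nat \<Rightarrow> nat \<Rightarrow> int \<Rightarrow> int" where
  "fix_coeff l n j i k = int (card {p \<in> colored_perms l n. cfix n p = j \<and> cfexc l n p = i \<and>
        int (cmaj n p) - int (cexc n p) = k})"

definition A_coeff :: "nat \<Rightarrow> nat \<Rightarrow> nat \<Rightarrow> int \<Rightarrow> int" where
  "A_coeff l n i k = int (card {p \<in> colored_perms l n. cfexc l n p = i \<and>
        int (cmaj n p) - int (cexc n p) = k})"

end

theory Submission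
  imports Defs "HOL-Computational_Algebra.Formal_Laurent_Series"
    "HOL-Computational_Algebra.Polynomial" "HOL-Library.Infinite_Set"
begin

text \<open>
  Write d(m) for the generating polynomial of the colored permutations of m letters without fixed
  points. Deleting the fixed points of a colored permutation leaves such a fixed-point-free
  one, and a fixed point compares with its neighbours as a letter above all non-exceeding and below all
  exceeding ones; a shuffle argument then gives the factor (n choose j)_q d(n - j) for j fixed points.
  A second relation comes from lowering every letter cyclically by one step in the color
  order: this turns fexc + 1 into fexc + l fix and controls maj - exc. Together they yield
  (1 - t) d(n) = sum over j >= 1 of (n choose j)_q (t - t^(lj)) d(n - j), that is
  d(n) = sum over j >= 1 of (n choose j)_q t [lj - 1]_t d(n - j), and likewise
  A(n) = sum over j >= 1 of (n choose j)_q [lj]_t d(n - j).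
  Multiplication by [b]_t preserves symmetry and unimodality, and all summands
  share the same center, so the theorem follows by induction.
\<close>

subsection \<open>q-binomial coefficients\<close>

text \<open>The cyclic shift trades excedances for weak excedances. With W(n) the sum of t^(fexc + l
  fix) q^(maj - exc - fix) it gives t A(n) = W(n) - t^l q^(-1) (1 - q^n) W(n - 1), where the
  correction stems from permutations whose shifted image ends in the fixed letter n. Sorting by the
  number j of fixed points expands both A and W over the d(n - j), with an extra factor (t^l
  q^(-1))^j for W. Absorption, (1 - q^n) (n-1 choose j-1)_q = (1 - q^j) (n choose j)_q, merges the
  correction with W(n): 1 - (1 - q^j) = q^j cancels q^(-j) and leaves t^(lj). This is the origin of
  the exponent lj. The negative power in t^l q^(-1) is the reason for Laurent series in q as
  coefficients of polynomials in t. They form an integral domain, so that 1 - t can be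
  cancelled.\<close>

fun qbinom :: "'a::comm_ring_1 \<Rightarrow> nat \<Rightarrow> nat \<Rightarrow> 'a" where
  "qbinom q n 0 = 1"
| "qbinom q 0 (Suc k) = 0"
| "qbinom q (Suc n) (Suc k) = qbinom q n k + q ^ Suc k * qbinom q n (Suc k)"

lemma qbinom_eq_0: "n < k \<Longrightarrow> qbinom q n k = 0"
proof (induction n arbitrary: k)
  case 0
  then show ?case by (cases k) auto
next
  case (Suc n)
  then show ?case by (cases k) auto
qed

text \<open>The mirror image of the defining q-Pascal rule. The shuffle sum needs both rules:
  descents and big letters decide which one applies.\<close>

lemma qbinom_Suc_Suc':
  "k \<le> n \<Longrightarrow> qbinom q (Suc n) (Suc k) = q ^ (n - k) * qbinom q n k + qbinom q n (Suc k)"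
proof (induction n arbitrary: k)
  case 0
  then show ?case by simp
next
  case (Suc n)
  show ?case
  proof (cases k)
    case 0
    then show ?thesis using Suc.IH[of 0] by (simp add: algebra_simps)
  next
    case k: (Suc i)
    have i: "i \<le> n" using Suc.prems k by simp
    show ?thesis
    proof (cases "i = n")
      case True
      then show ?thesis using k by (simp add: qbinom_eq_0)
    next
      case False
      then have "Suc i \<le> n" using i by simp
      then obtain d where d: "n = Suc i + d" using le_Suc_ex by blast
      have "qbinom q (Suc (Suc n)) (Suc k) = qbinom q (Suc n) (Suc i) + q ^ Suc (Suc i) * qbinom q (Suc n) (Suc (Suc i))"
        using k by simp
      also have "\<dots> = q ^ (n - i) * qbinom q n i + qbinom q n (Suc i)
          + q ^ Suc (Suc i) * (q ^ (n - Suc i) * qbinom q n (Suc i) + qbinom q n (Suc (Suc i)))"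
        using Suc.IH[of i] Suc.IH[of "Suc i"] i \<open>Suc i \<le> n\<close> by simp
      also have "\<dots> = q ^ (n - i) * (qbinom q n i + q ^ Suc i * qbinom q n (Suc i))
          + (qbinom q n (Suc i) + q ^ Suc (Suc i) * qbinom q n (Suc (Suc i)))"
        using d by (simp add: algebra_simps power_add)
      finally show ?thesis using k by simp
    qed
  qed
qed

text \<open>Obtained by eliminating \<open>qbinom q n (Suc k)\<close> between the two q-Pascal
  rules; free of division, since q is any ring element.\<close>

lemma qbinom_absorb:
  "(1 - q ^ Suc k) * qbinom q (Suc n) (Suc k) = (1 - q ^ Suc n) * qbinom q n k"
proof (cases "k \<le> n")
  case True
  then obtain d where n: "n = k + d" using le_Suc_ex by blast
  have 1: "qbinom q n (Suc k) = qbinom q (Suc n) (Suc k) - q ^ d * qbinom q n k"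
    using qbinom_Suc_Suc'[OF True, of q] n by simp
  have "qbinom q (Suc n) (Suc k) = qbinom q n k + q ^ Suc k * qbinom q n (Suc k)"
    by simp
  also have "\<dots> = qbinom q n k + q ^ Suc k * qbinom q (Suc n) (Suc k) - q ^ Suc n * qbinom q n k"
    unfolding 1 using n by (simp add: algebra_simps power_add)
  finally show ?thesis by (simp only: algebra_simps) (simp add: algebra_simps)
next
  case False
  then show ?thesis by (simp add: qbinom_eq_0 del: qbinom.simps)
qed

subsection \<open>Shuffling a word with an increasing sequence\<close>

text \<open>For p outside F this is the index of position p in the word that remains when the
  positions in F are deleted.\<close>

definition gap_rank :: "nat set \<Rightarrow> nat \<Rightarrow> nat" where
  "gap_rank F p = card ({1..p} - F)"

text \<open>
  Descents of a word whose positions in F carry an increasing sequence of letters lying above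
  the letters that are not big and below the big ones; D is the descent set of the word that
  remains when the positions in F are deleted.
\<close>

definition shuffle_des :: "(nat \<Rightarrow> bool) \<Rightarrow> (nat \<Rightarrow> bool) \<Rightarrow> nat set \<Rightarrow> nat \<Rightarrow> bool" where
  "shuffle_des D big F p \<longleftrightarrow>
     (if p \<in> F then Suc p \<notin> F \<and> \<not> big (gap_rank F (Suc p))
      else if Suc p \<in> F then big (gap_rank F p) else D (gap_rank F p))"

definition maj_upto :: "(nat \<Rightarrow> bool) \<Rightarrow> nat \<Rightarrow> nat" where
  "maj_upto D n = (\<Sum>p\<in>{1..<n}. if D p then p else 0)"

definition subsets_of_card :: "nat \<Rightarrow> nat \<Rightarrow> nat set set" where
  "subsets_of_card n j = {F. F \<subseteq> {1..n} \<and> card F = j}"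

lemma maj_upto_Suc: "0 < n \<Longrightarrow> maj_upto D (Suc n) = maj_upto D n + (if D n then n else 0)"
  by (cases n) (auto simp: maj_upto_def)

lemma maj_upto_cong: "(\<And>p. 1 \<le> p \<Longrightarrow> p < n \<Longrightarrow> D p = D' p) \<Longrightarrow> maj_upto D n = maj_upto D' n"
  unfolding maj_upto_def by (rule sum.cong) auto

lemma gap_rank_cong: "F \<inter> {1..p} = G \<inter> {1..p} \<Longrightarrow> gap_rank F p = gap_rank G p"
  unfolding gap_rank_def by (rule arg_cong[where f = card]) blast

lemma gap_rank_eq: "F \<subseteq> {1..p} \<Longrightarrow> gap_rank F p = p - card F"
  unfolding gap_rank_def by (simp add: card_Diff_subset finite_subset)

lemma finite_subsets_of_card: "finite (subsets_of_card n j)"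
  by (rule finite_subset[of _ "Pow {1..n}"]) (auto simp: subsets_of_card_def)

lemma subsets_of_card_Suc_notin:
  "{F \<in> subsets_of_card (Suc n) j. Suc n \<notin> F} = subsets_of_card n j"
  unfolding subsets_of_card_def by (auto simp: atLeastAtMostSuc_conv)

lemma subsets_of_card_Suc_in:
  "{F \<in> subsets_of_card (Suc n) (Suc j). Suc n \<in> F} = insert (Suc n) ` subsets_of_card n j"
proof (intro equalityI subsetI)
  fix F assume F: "F \<in> {F \<in> subsets_of_card (Suc n) (Suc j). Suc n \<in> F}"
  then have "F - {Suc n} \<in> subsets_of_card n j" "F = insert (Suc n) (F - {Suc n})"
    by (auto simp: subsets_of_card_def atLeastAtMostSuc_conv)
  then show "F \<in> insert (Suc n) ` subsets_of_card n j" by blast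
next
  fix F assume "F \<in> insert (Suc n) ` subsets_of_card n j"
  then obtain G where G: "F = insert (Suc n) G" "G \<subseteq> {1..n}" "card G = j"
    by (auto simp: subsets_of_card_def)
  moreover have "finite G" using G by (meson finite_atLeastAtMost finite_subset)
  moreover have "Suc n \<notin> G" using G by auto
  ultimately show "F \<in> {F \<in> subsets_of_card (Suc n) (Suc j). Suc n \<in> F}"
    by (auto simp: subsets_of_card_def)
qed

lemma sum_subsets_of_card_split:
  "(\<Sum>F\<in>subsets_of_card n j. f F) =
     (\<Sum>F | F \<in> subsets_of_card n j \<and> n \<in> F. f F) + (\<Sum>F | F \<in> subsets_of_card n j \<and> n \<notin> F. f F)"
  by (subst sum.union_disjoint[symmetric])
    (auto simp: finite_subsets_of_card intro!: sum.cong)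

text \<open>The assumption ties \<open>D\<close> to the order of letters: a step from a big letter
  to one that is not big is a descent, the opposite step an ascent. The shuffle theorem uses the
  letters only through \<open>D\<close> and \<open>big\<close>, so it is proved for predicates
  instead of words.\<close>

context
  fixes q :: "'a::comm_ring_1" and D big :: "nat \<Rightarrow> bool"
  assumes consistent: "\<And>i. 1 \<le> i \<Longrightarrow> big i \<noteq> big (Suc i) \<Longrightarrow> D i = big i"
begin

private definition wt :: "nat \<Rightarrow> nat set \<Rightarrow> 'a" where
  "wt n F = q ^ maj_upto (shuffle_des D big F) n"

text \<open>The shuffle sum is split by the status of the last position n: when position n + 1 is
  appended, n becomes a candidate for a descent, and the criterion depends on whether n lies in
  F.\<close>

private definition end_in :: "nat \<Rightarrow> nat \<Rightarrow> 'a" where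
  "end_in n j = (\<Sum>F | F \<in> subsets_of_card n j \<and> n \<in> F. wt n F)"

private definition end_out :: "nat \<Rightarrow> nat \<Rightarrow> 'a" where
  "end_out n j = (\<Sum>F | F \<in> subsets_of_card n j \<and> n \<notin> F. wt n F)"

text \<open>The new position n + 1 carries letter n + 1 - j of the remaining word. After a position
  in F it causes a descent unless it is big; otherwise \<open>D\<close> decides.\<close>

private lemma end_out_Suc:
  assumes "0 < n"
  shows "end_out (Suc n) j =
    (if big (Suc n - j) then 1 else q ^ n) * end_in n j + (if D (n - j) then q ^ n else 1) * end_out n j"
proof -
  have out: "wt (Suc n) F = (if shuffle_des D big F n then q ^ n else 1) * wt n F" for F
    using assms by (simp add: wt_def maj_upto_Suc power_add algebra_simps)
  have rank: "gap_rank F n = n - j" "gap_rank F (Suc n) = Suc n - j" "Suc n \<notin> F"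
    if "F \<in> subsets_of_card n j" for F
  proof -
    have F: "F \<subseteq> {1..n}" "card F = j" using that by (auto simp: subsets_of_card_def)
    then have "F \<subseteq> {1..Suc n}" by (auto simp: subset_iff le_SucI)
    with F show "gap_rank F n = n - j" "gap_rank F (Suc n) = Suc n - j" "Suc n \<notin> F"
      by (auto simp: gap_rank_eq)
  qed
  have "end_out (Suc n) j = (\<Sum>F\<in>subsets_of_card n j. wt (Suc n) F)"
    unfolding end_out_def subsets_of_card_Suc_notin ..
  also have "\<dots> = (\<Sum>F | F \<in> subsets_of_card n j \<and> n \<in> F. wt (Suc n) F)
      + (\<Sum>F | F \<in> subsets_of_card n j \<and> n \<notin> F. wt (Suc n) F)"
    by (rule sum_subsets_of_card_split)
  also have "(\<Sum>F | F \<in> subsets_of_card n j \<and> n \<in> F. wt (Suc n) F) =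
      (if big (Suc n - j) then 1 else q ^ n) * end_in n j"
    unfolding end_in_def sum_distrib_left out
    by (rule sum.cong) (auto simp: shuffle_des_def rank)
  also have "(\<Sum>F | F \<in> subsets_of_card n j \<and> n \<notin> F. wt (Suc n) F) =
      (if D (n - j) then q ^ n else 1) * end_out n j"
    unfolding end_out_def sum_distrib_left out
    by (rule sum.cong) (auto simp: shuffle_des_def rank)
  finally show ?thesis .
qed

private lemma end_in_Suc:
  assumes "0 < n"
  shows "end_in (Suc n) (Suc j) =
    end_in n j + (if big (n - j) then q ^ n else 1) * end_out n j"
proof -
  have rank: "gap_rank F n = n - j" "Suc n \<notin> F"
    if "F \<in> subsets_of_card n j" for F
    using that gap_rank_eq[of F n] by (auto simp: subsets_of_card_def)
  have out: "wt (Suc n) (insert (Suc n) F) = (if n \<notin> F \<and> big (n - j) then q ^ n else 1) * wt n F"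
    if F: "F \<in> subsets_of_card n j" for F
  proof -
    have "maj_upto (shuffle_des D big (insert (Suc n) F)) n = maj_upto (shuffle_des D big F) n"
    proof (rule maj_upto_cong)
      fix p assume "1 \<le> p" "p < n"
      then show "shuffle_des D big (insert (Suc n) F) p = shuffle_des D big F p"
        using gap_rank_cong[of "insert (Suc n) F" p F] gap_rank_cong[of "insert (Suc n) F" "Suc p" F]
        by (simp add: shuffle_des_def)
    qed
    moreover have "shuffle_des D big (insert (Suc n) F) n \<longleftrightarrow> n \<notin> F \<and> big (n - j)"
      using rank[OF F] gap_rank_cong[of "insert (Suc n) F" n F] by (auto simp: shuffle_des_def)
    ultimately show ?thesis
      using assms by (simp add: wt_def maj_upto_Suc power_add algebra_simps)
  qed
  have "end_in (Suc n) (Suc j) = (\<Sum>F\<in>subsets_of_card n j. wt (Suc n) (insert (Suc n) F))"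
    unfolding end_in_def subsets_of_card_Suc_in
    by (rule sum.reindex_cong[where l = "insert (Suc n)"]) (use rank(2) in \<open>auto intro!: inj_onI dest!: insert_ident[THEN iffD1, rotated 2]\<close>)
  also have "\<dots> = (\<Sum>F | F \<in> subsets_of_card n j \<and> n \<in> F. wt (Suc n) (insert (Suc n) F))
      + (\<Sum>F | F \<in> subsets_of_card n j \<and> n \<notin> F. wt (Suc n) (insert (Suc n) F))"
    by (rule sum_subsets_of_card_split)
  also have "(\<Sum>F | F \<in> subsets_of_card n j \<and> n \<in> F. wt (Suc n) (insert (Suc n) F)) = end_in n j"
    unfolding end_in_def by (rule sum.cong) (auto simp: out)
  also have "(\<Sum>F | F \<in> subsets_of_card n j \<and> n \<notin> F. wt (Suc n) (insert (Suc n) F)) =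
      (if big (n - j) then q ^ n else 1) * end_out n j"
    unfolding end_out_def sum_distrib_left by (rule sum.cong) (auto simp: out)
  finally show ?thesis .
qed

private lemma end_in_0 [simp]: "end_in n 0 = 0"
proof -
  have "{F \<in> subsets_of_card n 0. n \<in> F} = {}"
    by (auto simp: subsets_of_card_def dest: finite_subset)
  then show ?thesis unfolding end_in_def by (simp only: sum.empty)
qed

private lemma end_out_self [simp]:
  assumes "0 < n"
  shows "end_out n n = 0"
proof -
  have "F = {1..n}" if "F \<subseteq> {1..n}" "card F = n" for F
    using that by (intro card_subset_eq) auto
  then have "F = {1..n}" if "F \<in> subsets_of_card n n" for F
    using that unfolding subsets_of_card_def by blast
  moreover have "n \<in> {1..n}" using assms by simp
  ultimately have "{F \<in> subsets_of_card n n. n \<notin> F} = {}"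
    by blast
  then show ?thesis unfolding end_out_def by (simp only: sum.empty)
qed

private lemma end_1: "end_in (Suc 0) (Suc 0) = 1" "end_out (Suc 0) 0 = 1"
proof -
  have "{F \<in> subsets_of_card (Suc 0) (Suc 0). Suc 0 \<in> F} = {{1}}"
    "{F \<in> subsets_of_card (Suc 0) 0. Suc 0 \<notin> F} = {{}}"
    by (auto simp: subsets_of_card_def subset_singleton_iff)
  then show "end_in (Suc 0) (Suc 0) = 1" "end_out (Suc 0) 0 = 1"
    by (simp_all add: end_in_def end_out_def wt_def maj_upto_def)
qed

text \<open>Closed form of \<open>end_in (Suc (m + i)) (Suc i)\<close>: m positions lie outside F,
  and the binomial places the other i elements of F. The factor q^m is the descent at m that occurs
  when F fills the last positions.\<close>

private definition val_in :: "nat \<Rightarrow> nat \<Rightarrow> 'a" where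
  "val_in m i = (if big m then q ^ m else 1) * q ^ maj_upto D m * qbinom q (m + i) i"

text \<open>Closed form of \<open>end_out (Suc (m + j)) j\<close>. Here m + 1 positions lie outside
  F, the last position being one of them.\<close>

private definition val_out :: "nat \<Rightarrow> nat \<Rightarrow> 'a" where
  "val_out m j = (if big (Suc m) then 1 else q ^ j) * q ^ maj_upto D (Suc m) * qbinom q (m + j) j"

private lemma val_in_Suc:
  "val_in (Suc m) (Suc i) =
     val_in (Suc m) i + (if big (Suc m) then q ^ (Suc m + Suc i) else 1) * val_out m (Suc i)"
proof -
  have "qbinom q (Suc m + Suc i) (Suc i) = qbinom q (Suc m + i) i + q ^ Suc i * qbinom q (m + Suc i) (Suc i)"
    by simp
  then show ?thesis
    by (cases "big (Suc m)") (simp_all only: val_in_def val_out_def if_True if_False, simp_all only: power_add algebra_simps mult_1)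
qed

text \<open>The q-Pascal rules write B as B1 + y B2 or as x B1 + B2. If \<open>big\<close> agrees on
  the two letters, a descent calls for the first form and an ascent for the second. If it changes,
  consistency fixes \<open>D\<close> and the two forms exchange their roles.\<close>

private lemma val_out_Suc:
  "val_out (Suc m) (Suc i) =
     (if big (Suc (Suc m)) then 1 else q ^ (Suc m + Suc i)) * val_in (Suc m) i
     + (if D (Suc m) then q ^ (Suc m + Suc i) else 1) * val_out m (Suc i)"
proof -
  define B where "B = qbinom q (Suc m + Suc i) (Suc i)"
  define B1 where "B1 = qbinom q (Suc m + i) i"
  define B2 where "B2 = qbinom q (m + Suc i) (Suc i)"
  define M where "M = q ^ maj_upto D (Suc m)"
  define x where "x = q ^ Suc m"
  define y where "y = q ^ Suc i"
  have p1: "B = B1 + y * B2" by (simp add: B_def B1_def B2_def y_def)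
  have p2: "B = x * B1 + B2"
    using qbinom_Suc_Suc'[of i "Suc m + i" q] by (simp add: B_def B1_def B2_def x_def)
  have M: "q ^ maj_upto D (Suc (Suc m)) = (if D (Suc m) then x * M else M)"
    by (simp add: M_def x_def maj_upto_Suc power_add)
  have xy: "q ^ (Suc m + Suc i) = x * y" by (simp add: x_def y_def power_add)
  have cons: "big (Suc m) \<noteq> big (Suc (Suc m)) \<Longrightarrow> D (Suc m) = big (Suc m)"
    by (rule consistent) simp
  have "val_out (Suc m) (Suc i) = (if big (Suc (Suc m)) then 1 else y) * (if D (Suc m) then x * M else M) * B"
    by (simp only: val_out_def M B_def y_def)
  moreover have "val_in (Suc m) i = (if big (Suc m) then x else 1) * M * B1"
    by (simp only: val_in_def M_def B1_def x_def)
  moreover have "val_out m (Suc i) = (if big (Suc m) then 1 else y) * M * B2"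
    by (simp only: val_out_def M_def B2_def y_def)
  moreover have "(if big (Suc (Suc m)) then 1 else y) * (if D (Suc m) then x * M else M) * B =
    (if big (Suc (Suc m)) then 1 else x * y) * ((if big (Suc m) then x else 1) * M * B1)
     + (if D (Suc m) then x * y else 1) * ((if big (Suc m) then 1 else y) * M * B2)"
  proof (cases "big (Suc m) = big (Suc (Suc m))")
    case True
    show ?thesis
    proof (cases "D (Suc m)")
      case D: True
      show ?thesis using True D unfolding p1 by (cases "big (Suc m)") (simp_all add: algebra_simps)
    next
      case D: False
      show ?thesis using True D unfolding p2 by (cases "big (Suc m)") (simp_all add: algebra_simps)
    qed
  next
    case False
    then have "D (Suc m) = big (Suc m)" by (rule cons)
    moreover have "y * (x * M * B) = x * y * (x * M * B1) + x * y * (M * B2)" by (simp add: p2 algebra_simps)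
    moreover have "M * B = M * B1 + y * M * B2" by (simp add: p1 algebra_simps)
    ultimately show ?thesis using False
      by (cases "big (Suc m)") (simp_all add: mult.assoc)
  qed
  ultimately show ?thesis unfolding xy by simp
qed

text \<open>Each recurrence involves both sums of the previous length, so the closed forms are
  proved together. The cases i = 0 and m = 0 stand apart: there \<open>end_in n 0\<close>,
  respectively \<open>end_out n n\<close>, is an empty sum.\<close>

private lemma end_in_out:
  "m + i = n \<Longrightarrow> end_in (Suc n) (Suc i) = val_in m i \<and> end_out (Suc n) i = val_out m i"
proof (induction n arbitrary: m i)
  case 0
  then show ?case by (simp add: end_1 val_in_def val_out_def maj_upto_def)
next
  case (Suc n)
  show ?case
  proof (cases i)
    case 0
    then have "m = Suc n" "end_out (Suc n) 0 = val_out n 0"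
      using Suc.prems Suc.IH[of n 0] by simp_all
    then show ?thesis using 0
      by (simp add: end_in_Suc end_out_Suc val_in_def val_out_def maj_upto_Suc power_add)
  next
    case i: (Suc h)
    show ?thesis
    proof (cases m)
      case 0
      then have "i = Suc n" "end_in (Suc n) (Suc n) = val_in 0 n"
        using Suc.prems Suc.IH[of 0 n] by simp_all
      then show ?thesis using 0
        by (simp add: end_in_Suc end_out_Suc val_in_def val_out_def qbinom_eq_0 maj_upto_def)
    next
      case m: (Suc k)
      have n: "Suc n = Suc k + Suc h" "Suc n - Suc h = Suc k" "Suc (Suc n) - Suc h = Suc (Suc k)"
        using Suc.prems m i by simp_all
      have IH: "end_in (Suc n) (Suc h) = val_in (Suc k) h" "end_out (Suc n) (Suc h) = val_out k (Suc h)"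
        using Suc.IH[of "Suc k" h] Suc.IH[of k "Suc h"] n by simp_all
      have "end_in (Suc (Suc n)) (Suc (Suc h)) = val_in (Suc k) (Suc h)"
        unfolding end_in_Suc[OF zero_less_Suc] val_in_Suc IH n(2) unfolding n(1) ..
      moreover have "end_out (Suc (Suc n)) (Suc h) = val_out (Suc k) (Suc h)"
        unfolding end_out_Suc[OF zero_less_Suc] val_out_Suc IH n(2,3) unfolding n(1) ..
      ultimately show ?thesis unfolding m i ..
    qed
  qed
qed

text \<open>The two closed forms share the upper index n - 1, and their sum is one of the q-Pascal
  rules, chosen by whether the last remaining letter is big. Hence \<open>big\<close> disappears
  from the result.\<close>

lemma sum_shuffles:
  assumes "j \<le> n"
  shows "(\<Sum>F\<in>subsets_of_card n j. q ^ maj_upto (shuffle_des D big F) n) =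
    q ^ maj_upto D (n - j) * qbinom q n j"
proof -
  obtain m where n: "n = m + j" using assms le_Suc_ex by (metis add.commute)
  have "(\<Sum>F\<in>subsets_of_card n j. q ^ maj_upto (shuffle_des D big F) n) = end_in n j + end_out n j"
    unfolding end_in_def end_out_def wt_def by (rule sum_subsets_of_card_split)
  also have "\<dots> = q ^ maj_upto D m * qbinom q n j"
  proof (cases j)
    case 0
    show ?thesis
    proof (cases m)
      \<comment> \<open>The closed forms start at length 1, so the empty word is evaluated
        directly.\<close>
      case m: 0
      have "subsets_of_card 0 0 = {{}}" by (auto simp: subsets_of_card_def)
      then have "{F \<in> subsets_of_card 0 0. 0 \<notin> F} = {{}}" by auto
      then have "end_out 0 0 = 1" by (simp add: end_out_def wt_def maj_upto_def)
      then show ?thesis using 0 m n by (simp add: maj_upto_def)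
    next
      case (Suc k)
      then show ?thesis using 0 n end_in_out[of k 0 k] by (simp add: val_out_def)
    qed
  next
    case j: (Suc i)
    show ?thesis
    proof (cases m)
      case 0
      then show ?thesis using j n end_in_out[of 0 i i] by (simp add: val_in_def qbinom_eq_0)
    next
      case m: (Suc k)
      have n': "n = Suc (Suc k + i)" using n m j by simp
      define B1 B2 M where "B1 = qbinom q (Suc k + i) i" and "B2 = qbinom q (Suc k + i) j" and "M = q ^ maj_upto D m"
      have p1: "qbinom q n j = B1 + q ^ j * B2"
        unfolding n' j B1_def B2_def by simp
      have p2: "qbinom q n j = q ^ m * B1 + B2"
        unfolding n' j B1_def B2_def using qbinom_Suc_Suc'[of i "Suc k + i" q] m by simp
      have e: "end_in n j = (if big m then q ^ m else 1) * M * B1"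
        "end_out n j = (if big m then 1 else q ^ j) * M * B2"
        using end_in_out[of "Suc k" i "Suc k + i"] end_in_out[of k j "Suc k + i"]
        unfolding n' m j val_in_def val_out_def M_def B1_def B2_def by simp_all
      show ?thesis unfolding e M_def[symmetric]
      proof (cases "big m")
        case True
        then show "(if big m then q ^ m else 1) * M * B1 + (if big m then 1 else q ^ j) * M * B2 = M * qbinom q n j"
          unfolding p2 by (simp add: algebra_simps)
      next
        case False
        then show "(if big m then q ^ m else 1) * M * B1 + (if big m then 1 else q ^ j) * M * B2 = M * qbinom q n j"
          unfolding p1 by (simp add: algebra_simps)
      qed
    qed
  qed
  finally show ?thesis using n by simp
qed

end

subsection \<open>Deleting fixed points\<close>

text \<open>The monomial t^i q^k, as a polynomial in t over the Laurent series in q.\<close>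

definition tq_mono :: "nat \<Rightarrow> int \<Rightarrow> int fls poly" where
  "tq_mono i k = monom (fls_X_intpow k) i"

lemma tq_mono_mult: "tq_mono a b * tq_mono c d = tq_mono (a + c) (b + d)"
  by (simp add: tq_mono_def mult_monom fls_X_intpow_times_fls_X_intpow)

lemma tq_mono_0: "tq_mono 0 0 = 1"
  by (simp add: tq_mono_def)

lemma tq_mono_power: "tq_mono a b ^ n = tq_mono (n * a) (int n * b)"
  by (simp add: tq_mono_def monom_power fls_X_intpow_power mult.commute)

section \<open>Transport of colored permutations along the complement of their fixed point
  set\<close>

definition fixset :: "nat \<Rightarrow> (nat \<Rightarrow> nat) \<times> (nat \<Rightarrow> nat) \<Rightarrow> nat set" where
  "fixset n p = {i \<in> {1..n}. fst p i = i \<and> snd p i = 0}"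

definition cdes :: "(nat \<Rightarrow> nat) \<times> (nat \<Rightarrow> nat) \<Rightarrow> nat \<Rightarrow> bool" where
  "cdes p i = col_less (fst p (i + 1), snd p (i + 1)) (fst p i, snd p i)"

definition cexceeds :: "(nat \<Rightarrow> nat) \<times> (nat \<Rightarrow> nat) \<Rightarrow> nat \<Rightarrow> bool" where
  "cexceeds p i \<longleftrightarrow> snd p i = 0 \<and> fst p i > i"

lemma cfix_eq: "cfix n p = card (fixset n p)"
  by (simp add: cfix_def fixset_def)

lemma cmaj_eq: "cmaj n p = maj_upto (cdes p) n"
proof -
  have "{1..n - 1} = {1..<n}" by auto
  then show ?thesis
    unfolding cmaj_def maj_upto_def cdes_def by (simp only: sum.inter_filter[OF finite_atLeastLessThan])
qed

lemma colored_perms_iff: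
  "p \<in> colored_perms l n \<longleftrightarrow> fst p permutes {1..n} \<and> (\<forall>i. snd p i < l) \<and> (\<forall>i. i \<notin> {1..n} \<longrightarrow> snd p i = 0)"
  by (cases p) (simp add: colored_perms_def)

lemma finite_colored_perms: "finite (colored_perms l n)"
proof (rule finite_subset)
  show "colored_perms l n \<subseteq> {\<sigma>. \<sigma> permutes {1..n}} \<times>
      {f. \<forall>x. (x \<in> {1..n} \<longrightarrow> f x \<in> {..<l}) \<and> (x \<notin> {1..n} \<longrightarrow> f x = 0)}"
    by (auto simp: colored_perms_def)
qed (intro finite_cartesian_product finite_permutations finite_set_of_finite_funs; simp)

text \<open>
  Conjugation by a bijection that maps the first m positions increasingly onto the complement of
  F turns fixed-point-free colored permutations of m letters into those of n
  letters with fixed point set F.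
\<close>

definition conj_perm :: "(nat \<Rightarrow> nat) \<Rightarrow> (nat \<Rightarrow> nat) \<times> (nat \<Rightarrow> nat) \<Rightarrow> (nat \<Rightarrow> nat) \<times> (nat \<Rightarrow> nat)" where
  "conj_perm e p = (e \<circ> fst p \<circ> inv e, snd p \<circ> inv e)"

text \<open>The enumeration of the complement of F is completed to a permutation of {1..n}, so that
  conjugation by it is invertible. On {m+1..n} any bijection onto F will do, because the
  permutations to be conjugated are the identity there.\<close>

lemma obtain_gap_enumeration:
  fixes F :: "nat set"
  assumes F: "F \<subseteq> {1..n}" and m: "m = n - card F"
  obtains e where "e permutes {1..n}" "strict_mono_on {1..m} e" "e ` {1..m} = {1..n} - F"
    "\<And>k. k \<in> {1..m} \<Longrightarrow> gap_rank F (e k) = k"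
proof -
  have finF: "finite F" using F finite_subset by blast
  have cF: "card F \<le> n" using card_mono[OF _ F] by simp
  have cM: "card ({1..n} - F) = m" using F finF m by (simp add: card_Diff_subset)
  obtain h where h: "bij_betw h {..<m} ({1..n} - F)" "strict_mono_on {..<m} h"
    using ex_bij_betw_strict_mono_card[of "{1..n} - F"] cM by auto
  have "bij_betw (\<lambda>k. k - 1) {1..m} {..<m}"
    by (rule bij_betw_byWitness[where f' = Suc]) auto
  then have h': "bij_betw (\<lambda>k. h (k - 1)) {1..m} ({1..n} - F)"
    using bij_betw_trans[OF _ h(1)] by (auto simp: comp_def)
  have "card {m+1..n} = card F" using m cF by simp
  then obtain g where g: "bij_betw g {m+1..n} F"
    using finite_same_card_bij[of "{m+1..n}" F] finF by auto
  define e where "e k = (if k \<in> {1..m} then h (k - 1) else if k \<in> {m+1..n} then g k else k)" for k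
  have e1: "bij_betw e {1..m} ({1..n} - F)"
    using h' by (rule bij_betw_cong[THEN iffD1, rotated]) (simp add: e_def)
  have e2: "bij_betw e {m+1..n} F"
    using g by (rule bij_betw_cong[THEN iffD1, rotated]) (simp add: e_def)
  have "bij_betw e ({1..m} \<union> {m+1..n}) (({1..n} - F) \<union> F)"
    by (rule bij_betw_combine[OF e1 e2]) auto
  moreover have "{1..m} \<union> {m+1..n} = {1..n}" using m by auto
  moreover have "({1..n} - F) \<union> F = {1..n}" using F by auto
  ultimately have "bij_betw e {1..n} {1..n}" by simp
  then have perm: "e permutes {1..n}"
    by (rule bij_imp_permutes) (use m in \<open>auto simp: e_def\<close>)
  have mono: "strict_mono_on {1..m} e"
  proof (rule strict_mono_onI)
    fix r s assume "r \<in> {1..m}" "s \<in> {1..m}" "r < s"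
    then show "e r < e s"
      using strict_mono_onD[OF h(2), of "r - 1" "s - 1"] unfolding e_def
      by (simp add: less_diff_conv2 less_diff_conv)
  qed
  have rank: "gap_rank F (e k) = k" if k: "k \<in> {1..m}" for k
  proof -
    have im: "e ` {1..m} = {1..n} - F" using e1 by (simp add: bij_betw_def)
    have "{1..e k} - F = e ` {1..k}"
    proof (intro equalityI subsetI)
      fix x assume x: "x \<in> {1..e k} - F"
      moreover have "e k \<le> n" using im k by auto
      ultimately have "x \<in> e ` {1..m}" unfolding im by auto
      then obtain i where i: "i \<in> {1..m}" "x = e i" by blast
      have "i \<le> k"
        using strict_mono_onD[OF mono k i(1)] x i by fastforce
      then show "x \<in> e ` {1..k}" using i by auto
    next
      fix x assume "x \<in> e ` {1..k}"
      then obtain i where i: "i \<in> {1..k}" "x = e i" by blast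
      then have "i \<in> {1..m}" using k by auto
      then have "e i \<in> {1..n} - F" using im by blast
      moreover have "e i \<le> e k"
        using strict_mono_onD[OF mono \<open>i \<in> {1..m}\<close> k] i by (cases "i = k") auto
      ultimately show "x \<in> {1..e k} - F" using i by auto
    qed
    moreover have "inj_on e {1..k}"
      using permutes_inj[OF perm] by (rule inj_on_subset) simp
    ultimately show ?thesis by (simp add: gap_rank_def card_image)
  qed
  show thesis
    by (rule that[OF perm mono _ rank]) (use e1 in \<open>auto simp: bij_betw_def\<close>)
qed

context
  fixes l n m :: nat and F :: "nat set" and e :: "nat \<Rightarrow> nat"
  assumes F: "F \<subseteq> {1..n}" and m: "m \<le> n"
    and perm: "e permutes {1..n}" and mono: "strict_mono_on {1..m} e"
    and im: "e ` {1..m} = {1..n} - F" and rank: "\<And>k. k \<in> {1..m} \<Longrightarrow> gap_rank F (e k) = k"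
begin

private lemma inv_e [simp]: "inv e (e k) = k" "e (inv e i) = i"
  using perm by (simp_all add: permutes_inverses)

private lemma e_eq [simp]: "e i = e k \<longleftrightarrow> i = k"
  using permutes_inj[OF perm] by (simp add: inj_eq)

private lemma e_in: "e k \<in> {1..n} \<longleftrightarrow> k \<in> {1..n}"
  by (rule permutes_in_image[OF perm])

private lemma e_in_F: "e k \<in> F \<longleftrightarrow> k \<in> {1..n} \<and> k \<notin> {1..m}"
proof -
  have "e k \<in> {1..n} - F \<longleftrightarrow> k \<in> {1..m}"
    unfolding im[symmetric] by auto
  then show ?thesis using e_in[of k] F by blast
qed

private lemma e_less: "i \<in> {1..m} \<Longrightarrow> k \<in> {1..m} \<Longrightarrow> e i < e k \<longleftrightarrow> i < k"
  using mono by (rule strict_mono_on_less)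

text \<open>In this encoding a colored permutation of m letters fixes m+1, ..., n with color 0.
  These points become F, and no further fixed points arise because {1..m} contains none.\<close>

private lemma conj_in:
  assumes p: "p \<in> colored_perms l m" and d: "fixset m p = {}"
  shows "conj_perm e p \<in> colored_perms l n" "fixset n (conj_perm e p) = F"
proof -
  have p': "fst p permutes {1..m}" "\<And>i. snd p i < l" "\<And>i. i \<notin> {1..m} \<Longrightarrow> snd p i = 0"
    using p by (auto simp: colored_perms_iff)
  have "fst p permutes {1..n}" by (rule permutes_subset[OF p'(1)]) (use m in auto)
  then have "e \<circ> fst p \<circ> inv e permutes {1..n}"
    by (metis permutes_compose perm permutes_inv comp_assoc)
  moreover have "snd p (inv e i) = 0" if "i \<notin> {1..n}" for i
    using that e_in[of "inv e i"] m by (intro p'(3)) auto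
  ultimately show "conj_perm e p \<in> colored_perms l n"
    using p'(2) by (auto simp: colored_perms_iff conj_perm_def)
  have "i \<in> fixset n (conj_perm e p) \<longleftrightarrow> i \<in> F" for i
  proof -
    define k where "k = inv e i"
    have i: "i = e k" by (simp add: k_def)
    have "i \<in> fixset n (conj_perm e p) \<longleftrightarrow> k \<in> {1..n} \<and> fst p k = k \<and> snd p k = 0"
      unfolding i fixset_def conj_perm_def using e_in[of k] by auto
    also have "\<dots> \<longleftrightarrow> k \<in> {1..n} \<and> k \<notin> {1..m}"
      using d p'(3)[of k] permutes_not_in[OF p'(1), of k] by (auto simp: fixset_def)
    finally show ?thesis using e_in_F[of k] i by simp
  qed
  then show "fixset n (conj_perm e p) = F" by blast
qed

private lemma conj_inv_in:
  assumes p: "p \<in> colored_perms l n" and d: "fixset n p = F"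
  shows "conj_perm (inv e) p \<in> colored_perms l m" "fixset m (conj_perm (inv e) p) = {}"
proof -
  have p': "fst p permutes {1..n}" "\<And>i. snd p i < l" "\<And>i. i \<notin> {1..n} \<Longrightarrow> snd p i = 0"
    using p by (auto simp: colored_perms_iff)
  have c: "conj_perm (inv e) p = (inv e \<circ> fst p \<circ> e, snd p \<circ> e)"
    using permutes_inv_inv[OF perm] by (simp add: conj_perm_def)
  have fixed: "fst p (e k) = e k" "snd p (e k) = 0" if "k \<in> {1..n}" "k \<notin> {1..m}" for k
    using e_in_F[of k] that d by (auto simp: fixset_def)
  have "inv e \<circ> fst p \<circ> e permutes {1..n}"
    by (metis permutes_compose perm permutes_inv comp_assoc p'(1))
  then have "inv e \<circ> fst p \<circ> e permutes {1..m}"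
    by (rule permutes_superset) (auto simp: fixed)
  moreover have "snd p (e k) = 0" if "k \<notin> {1..m}" for k
    using fixed(2)[of k] p'(3)[of "e k"] e_in[of k] that by blast
  ultimately show "conj_perm (inv e) p \<in> colored_perms l m"
    unfolding c using p'(2) by (auto simp: colored_perms_iff)
  show "fixset m (conj_perm (inv e) p) = {}"
  proof -
    have False if k: "k \<in> {1..m}" "inv e (fst p (e k)) = k" "snd p (e k) = 0" for k
    proof -
      have "fst p (e k) = e k" using k(2) inv_e(2)[of "fst p (e k)"] by simp
      then have "e k \<in> fixset n p" using k m e_in[of k] by (auto simp: fixset_def)
      then show False using d e_in_F[of k] k by auto
    qed
    then show ?thesis unfolding c fixset_def by auto
  qed
qed

private lemma bij_conj:
  "bij_betw (conj_perm e) {p \<in> colored_perms l m. fixset m p = {}} {p \<in> colored_perms l n. fixset n p = F}"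
proof (rule bij_betw_byWitness[where f' = "conj_perm (inv e)"])
  show "\<forall>p\<in>{p \<in> colored_perms l m. fixset m p = {}}. conj_perm (inv e) (conj_perm e p) = p"
    "\<forall>p\<in>{p \<in> colored_perms l n. fixset n p = F}. conj_perm e (conj_perm (inv e) p) = p"
    using permutes_inv_inv[OF perm] by (auto simp: conj_perm_def fun_eq_iff)
qed (use conj_in conj_inv_in in auto)

text \<open>Since e increases on {1..m}, comparisons of letters with each other and with their
  positions survive. Only the positions of descents change, and next to a fixed point a descent is
  decided by whether the neighbor exceeds.\<close>

private lemma conj_stats:
  assumes p: "p \<in> colored_perms l m" and d: "fixset m p = {}"
  shows "cexc n (conj_perm e p) = cexc m p" "cfexc l n (conj_perm e p) = cfexc l m p"
    "cmaj n (conj_perm e p) = maj_upto (shuffle_des (cdes p) (cexceeds p) F) n"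
proof -
  have p': "fst p permutes {1..m}" "\<And>i. snd p i < l" "\<And>i. i \<notin> {1..m} \<Longrightarrow> snd p i = 0"
    using p by (auto simp: colored_perms_iff)
  define p2 where "p2 = conj_perm e p"
  have val: "fst p2 (e k) = e (fst p k)" "snd p2 (e k) = snd p k" for k
    by (simp_all add: p2_def conj_perm_def)
  have p_in: "fst p k \<in> {1..m}" if "k \<in> {1..m}" for k
    using that permutes_in_image[OF p'(1)] by simp
  have p_fix: "fst p k = k" "snd p k = 0" if "k \<notin> {1..m}" for k
    using that p'(3) permutes_not_in[OF p'(1)] by auto
  have in_F: "fst p2 i = i" "snd p2 i = 0" if "i \<in> F" for i
  proof -
    have "inv e i \<notin> {1..m}" using e_in_F[of "inv e i"] that by simp
    then show "fst p2 i = i" "snd p2 i = 0"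
      using val[of "inv e i"] p_fix[of "inv e i"] by auto
  qed
  have exc: "cexceeds p2 (e k) \<longleftrightarrow> cexceeds p k" if "k \<in> {1..m}" for k
    using that p_in[OF that] by (simp add: cexceeds_def val e_less del: atLeastAtMost_iff)
  have "{i \<in> {1..n}. snd p2 i = 0 \<and> i < fst p2 i} = e ` {k \<in> {1..m}. snd p k = 0 \<and> k < fst p k}"
  proof (intro equalityI subsetI)
    fix i assume i: "i \<in> {i \<in> {1..n}. snd p2 i = 0 \<and> i < fst p2 i}"
    then have "i \<in> {1..n} - F" using in_F[of i] by auto
    then obtain k where k: "k \<in> {1..m}" "i = e k" unfolding im[symmetric] by blast
    then show "i \<in> e ` {k \<in> {1..m}. snd p k = 0 \<and> k < fst p k}"
      using exc[OF k(1)] i by (auto simp: cexceeds_def)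
  next
    fix i assume "i \<in> e ` {k \<in> {1..m}. snd p k = 0 \<and> k < fst p k}"
    then obtain k where k: "k \<in> {1..m}" "i = e k" "snd p k = 0" "k < fst p k" by blast
    then show "i \<in> {i \<in> {1..n}. snd p2 i = 0 \<and> i < fst p2 i}"
      using exc[OF k(1)] im by (auto simp: cexceeds_def)
  qed
  then show exc_eq: "cexc n (conj_perm e p) = cexc m p"
    unfolding p2_def cexc_def by (simp add: card_image inj_on_def)
  have "(\<Sum>i=1..n. snd p2 i) = (\<Sum>i=1..n. (snd p2 \<circ> e) i)"
    by (rule sum.permute[OF perm])
  also have "\<dots> = (\<Sum>k=1..n. snd p k)" by (simp add: val)
  also have "\<dots> = (\<Sum>k=1..m. snd p k)"
    by (rule sum.mono_neutral_right) (use m p'(3) in auto)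
  finally show "cfexc l n (conj_perm e p) = cfexc l m p"
    using exc_eq by (simp add: cfexc_def p2_def)
  show "cmaj n (conj_perm e p) = maj_upto (shuffle_des (cdes p) (cexceeds p) F) n"
    unfolding cmaj_eq p2_def[symmetric]
  proof (rule maj_upto_cong)
    fix i assume i: "1 \<le> i" "i < n"
    have inj: "fst p2 a = fst p2 b \<longleftrightarrow> a = b" for a b
    proof -
      have "fst p2 permutes {1..n}"
        using conj_in(1)[OF p d] by (simp only: colored_perms_iff p2_def)
      then show ?thesis by (rule inj_eq[OF permutes_inj])
    qed
    have gap: "\<exists>k\<in>{1..m}. a = e k \<and> gap_rank F a = k" if "a \<in> {1..n}" "a \<notin> F" for a
    proof -
      have "a \<in> e ` {1..m}" unfolding im using that by simp
      then obtain k where "k \<in> {1..m}" "a = e k" by (rule imageE)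
      with rank[of k] show ?thesis by blast
    qed
    show "cdes p2 i = shuffle_des (cdes p) (cexceeds p) F i"
    proof (cases "i \<in> F")
      case iF: True
      show ?thesis
      proof (cases "Suc i \<in> F")
        case True
        then show ?thesis using iF in_F by (simp add: cdes_def shuffle_des_def col_less_def)
      next
        case False
        then obtain k where k: "k \<in> {1..m}" "Suc i = e k" "gap_rank F (Suc i) = k"
          using gap[of "Suc i"] i by auto
        \<comment> \<open>For color 0, a descent at i means a value below i, while not exceeding
          means a value at most i + 1. The values i and i + 1 are excluded by injectivity and by the
          absence of a fixed point.\<close>
        have "fst p2 (Suc i) \<noteq> i" using inj[of "Suc i" i] in_F[OF iF] by simp
        moreover have "\<not> (fst p2 (Suc i) = Suc i \<and> snd p2 (Suc i) = 0)"
          using d k p_in by (auto simp: val fixset_def)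
        ultimately show ?thesis
          using False iF in_F[OF iF] exc[OF k(1)] k
          by (auto simp: cdes_def shuffle_des_def col_less_def cexceeds_def)
      qed
    next
      case iF: False
      then obtain k where k: "k \<in> {1..m}" "i = e k" "gap_rank F i = k"
        using gap[of i] i by auto
      show ?thesis
      proof (cases "Suc i \<in> F")
        case True
        \<comment> \<open>Only the value i + 1 could exceed i without lying above the fixed letter i
          + 1.\<close>
        have "fst p2 i \<noteq> Suc i" using inj[of "Suc i" i] in_F[OF True] by simp
        then show ?thesis
          using True iF in_F[OF True] exc[OF k(1)] k
          by (auto simp: cdes_def shuffle_des_def col_less_def cexceeds_def)
      next
        case False
        then obtain k' where k': "k' \<in> {1..m}" "Suc i = e k'" "gap_rank F (Suc i) = k'"
          using gap[of "Suc i"] i by auto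
        have "gap_rank F (Suc i) = Suc (gap_rank F i)"
        proof -
          have "{1..Suc i} - F = insert (Suc i) ({1..i} - F)" using False by auto
          then show ?thesis by (simp add: gap_rank_def)
        qed
        then have "k' = Suc k" using k(3) k'(3) by simp
        have v: "fst p2 i = e (fst p k)" "snd p2 i = snd p k"
          "fst p2 (Suc i) = e (fst p k')" "snd p2 (Suc i) = snd p k'"
          using val[of k] val[of k'] k(2) k'(2) by simp_all
        have "shuffle_des (cdes p) (cexceeds p) F i \<longleftrightarrow> cdes p k"
          using False iF k(3) by (simp add: shuffle_des_def)
        also have "\<dots> \<longleftrightarrow> cdes p2 i"
          using e_less[OF p_in[OF k'(1)] p_in[OF k(1)]] v \<open>k' = Suc k\<close>
          by (simp add: cdes_def col_less_def)
        finally show ?thesis ..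
      qed
    qed
  qed
qed

lemma sum_conj:
  "(\<Sum>p | p \<in> colored_perms l n \<and> fixset n p = F. f (cfexc l n p) (cexc n p) (cmaj n p)) =
   (\<Sum>p | p \<in> colored_perms l m \<and> fixset m p = {}.
      f (cfexc l m p) (cexc m p) (maj_upto (shuffle_des (cdes p) (cexceeds p) F) n))"
  by (subst sum.reindex_bij_betw[OF bij_conj, symmetric]) (auto simp: conj_stats intro!: sum.cong)

end

section \<open>Generating polynomials by number of fixed points\<close>

definition wt_poly :: "nat \<Rightarrow> nat \<Rightarrow> (nat \<Rightarrow> nat) \<times> (nat \<Rightarrow> nat) \<Rightarrow> int fls poly" where
  "wt_poly l n p = tq_mono (cfexc l n p) (int (cmaj n p) - int (cexc n p))"

definition fix_poly :: "nat \<Rightarrow> nat \<Rightarrow> nat \<Rightarrow> int fls poly" where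
  "fix_poly l n j = (\<Sum>p | p \<in> colored_perms l n \<and> cfix n p = j. wt_poly l n p)"

text \<open>The hypothesis of \<open>sum_shuffles\<close>. If only i exceeds, its letter is at least
  i + 1 in color 0, the next one at most i + 1 or of positive color. If only i + 1 exceeds, the
  letter at i is below i or of positive color, as it is not fixed.\<close>

lemma consistent_exc_des:
  assumes p: "p \<in> colored_perms l m" and d: "fixset m p = {}" and i: "1 \<le> i"
    and ne: "cexceeds p i \<noteq> cexceeds p (Suc i)"
  shows "cdes p i = cexceeds p i"
proof -
  have p': "fst p permutes {1..m}" "\<And>i. i \<notin> {1..m} \<Longrightarrow> snd p i = 0"
    using p by (auto simp: colored_perms_iff)
  have out: "\<not> cexceeds p i" if "i \<notin> {1..m}" for i
    using that permutes_not_in[OF p'(1)] by (simp add: cexceeds_def)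
  have im: "i \<in> {1..m}"
  proof (rule ccontr)
    assume "i \<notin> {1..m}"
    then have "Suc i \<notin> {1..m}" using i by simp
    with \<open>i \<notin> {1..m}\<close> show False using ne out by blast
  qed
  have inj: "fst p (Suc i) \<noteq> fst p i" using permutes_inj[OF p'(1)] by (simp add: inj_eq)
  show ?thesis
  proof (cases "cexceeds p i")
    case True
    then have "fst p (Suc i) \<le> Suc i" if "snd p (Suc i) = 0" using ne that by (auto simp: cexceeds_def)
    then show ?thesis using True inj by (auto simp: cexceeds_def cdes_def col_less_def)
  next
    case False
    then have "fst p (Suc i) > Suc i" "snd p (Suc i) = 0" using ne by (auto simp: cexceeds_def)
    moreover have "\<not> (fst p i = i \<and> snd p i = 0)" using d im by (auto simp: fixset_def)
    ultimately show ?thesis using False by (auto simp: cexceeds_def cdes_def col_less_def)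
  qed
qed

text \<open>Every fixed point set F of size j leads to the same derangements of n - j letters, and
  only maj remembers F. Interchanging the sums leaves one shuffle sum for each derangement.\<close>

lemma fix_poly_eq:
  assumes "j \<le> n"
  shows "fix_poly l n j = qbinom (tq_mono 0 1) n j * fix_poly l (n - j) 0"
proof -
  define m where "m = n - j"
  define Der where "Der = {p \<in> colored_perms l m. fixset m p = {}}"
  have Der: "{p. p \<in> colored_perms l m \<and> cfix m p = 0} = Der"
    unfolding Der_def cfix_eq fixset_def by auto
  \<comment> \<open>Splitting off the power of q that may be negative leaves a natural power, as
    \<open>sum_shuffles\<close> requires.\<close>
  have q: "tq_mono a (int b - c) = tq_mono a (- c) * tq_mono 0 1 ^ b" for a b c
    by (simp add: tq_mono_power tq_mono_mult)
  have "fix_poly l n j = (\<Sum>F\<in>subsets_of_card n j.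
      \<Sum>p | p \<in> {p. p \<in> colored_perms l n \<and> cfix n p = j} \<and> fixset n p = F. wt_poly l n p)"
    unfolding fix_poly_def
    by (rule sum.group[symmetric])
      (auto simp: finite_colored_perms finite_subsets_of_card cfix_eq subsets_of_card_def fixset_def)
  also have "\<dots> = (\<Sum>F\<in>subsets_of_card n j. \<Sum>p\<in>Der.
      tq_mono (cfexc l m p) (int (maj_upto (shuffle_des (cdes p) (cexceeds p) F) n) - int (cexc m p)))"
  proof (rule sum.cong[OF refl])
    fix F assume "F \<in> subsets_of_card n j"
    then have F: "F \<subseteq> {1..n}" "card F = j" by (auto simp: subsets_of_card_def)
    obtain e where e: "e permutes {1..n}" "strict_mono_on {1..m} e" "e ` {1..m} = {1..n} - F"
      "\<And>k. k \<in> {1..m} \<Longrightarrow> gap_rank F (e k) = k"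
      using obtain_gap_enumeration[OF F(1), of m] F(2) m_def by blast
    have "{p. p \<in> {p. p \<in> colored_perms l n \<and> cfix n p = j} \<and> fixset n p = F} =
        {p. p \<in> colored_perms l n \<and> fixset n p = F}"
      using F by (auto simp: cfix_eq)
    then show "(\<Sum>p | p \<in> {p. p \<in> colored_perms l n \<and> cfix n p = j} \<and> fixset n p = F. wt_poly l n p) =
      (\<Sum>p\<in>Der. tq_mono (cfexc l m p) (int (maj_upto (shuffle_des (cdes p) (cexceeds p) F) n) - int (cexc m p)))"
      using sum_conj[OF F(1) _ e, of "\<lambda>a b c. tq_mono a (int c - int b)" l]
      by (simp add: wt_poly_def Der_def m_def)
  qed
  also have "\<dots> = (\<Sum>p\<in>Der. \<Sum>F\<in>subsets_of_card n j.
      tq_mono (cfexc l m p) (- int (cexc m p)) * tq_mono 0 1 ^ maj_upto (shuffle_des (cdes p) (cexceeds p) F) n)"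
    unfolding q by (rule sum.swap)
  also have "\<dots> = (\<Sum>p\<in>Der. tq_mono (cfexc l m p) (- int (cexc m p)) *
      (tq_mono 0 1 ^ maj_upto (cdes p) m * qbinom (tq_mono 0 1) n j))"
  proof (rule sum.cong[OF refl])
    fix p assume p: "p \<in> Der"
    then have p': "p \<in> colored_perms l m" "fixset m p = {}" by (simp_all add: Der_def)
    have "(\<Sum>F\<in>subsets_of_card n j. tq_mono 0 1 ^ maj_upto (shuffle_des (cdes p) (cexceeds p) F) n) =
        tq_mono 0 1 ^ maj_upto (cdes p) m * qbinom (tq_mono 0 1) n j"
      unfolding m_def
      by (rule sum_shuffles[OF consistent_exc_des[OF p'] assms])
    then show "(\<Sum>F\<in>subsets_of_card n j.
      tq_mono (cfexc l m p) (- int (cexc m p)) * tq_mono 0 1 ^ maj_upto (shuffle_des (cdes p) (cexceeds p) F) n) =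
      tq_mono (cfexc l m p) (- int (cexc m p)) * (tq_mono 0 1 ^ maj_upto (cdes p) m * qbinom (tq_mono 0 1) n j)"
      by (simp add: sum_distrib_left[symmetric])
  qed
  also have "\<dots> = qbinom (tq_mono 0 1) n j * (\<Sum>p\<in>Der. wt_poly l m p)"
    unfolding sum_distrib_left
    by (rule sum.cong) (simp_all add: wt_poly_def cmaj_eq q algebra_simps)
  finally show ?thesis
    unfolding fix_poly_def m_def[symmetric] Der .
qed

subsection \<open>Cyclic shift in the color order\<close>

definition cyc_dec :: "nat \<Rightarrow> nat \<Rightarrow> nat" where
  "cyc_dec n v = (if v \<in> {1..n} then if v = 1 then n else v - 1 else v)"

text \<open>
  Every letter is replaced by its predecessor in the color order, and the least letter 1 of
  color l - 1 by the greatest letter n of color 0.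
\<close>

definition shift_perm :: "nat \<Rightarrow> nat \<Rightarrow> (nat \<Rightarrow> nat) \<times> (nat \<Rightarrow> nat) \<Rightarrow> (nat \<Rightarrow> nat) \<times> (nat \<Rightarrow> nat)" where
  "shift_perm l n p =
     (cyc_dec n \<circ> fst p, \<lambda>i. if fst p i = 1 then (snd p i + 1) mod l else snd p i)"

lemma cyc_dec_permutes: "cyc_dec n permutes {1..n}"
proof (rule bij_imp_permutes)
  show "bij_betw (cyc_dec n) {1..n} {1..n}"
    by (rule bij_betw_byWitness[where f' = "\<lambda>v. if v = n then 1 else v + 1"])
      (auto simp: cyc_dec_def)
qed (simp only: cyc_dec_def if_False)

lemma shift_perm_in:
  assumes "1 \<le> n" and p: "p \<in> colored_perms l n"
  shows "shift_perm l n p \<in> colored_perms l n"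
proof -
  have p': "fst p permutes {1..n}" "\<And>i. snd p i < l" "\<And>i. i \<notin> {1..n} \<Longrightarrow> snd p i = 0"
    using p by (auto simp: colored_perms_iff)
  have "fst p i = i" "i \<noteq> 1" if "i \<notin> {1..n}" for i
    using that permutes_not_in[OF p'(1)] assms(1) by auto
  moreover have "(a + 1) mod l < l" for a
    using p'(2)[of 0] by simp
  ultimately show ?thesis
    using p'(2,3) permutes_compose[OF p'(1) cyc_dec_permutes]
    by (simp add: colored_perms_iff shift_perm_def)
qed

lemma bij_shift_perm:
  assumes "1 \<le> n"
  shows "bij_betw (shift_perm l n) (colored_perms l n) (colored_perms l n)"
proof -
  have "inj_on (shift_perm l n) (colored_perms l n)"
  proof (rule inj_onI)
    fix p p' assume p: "p \<in> colored_perms l n" and p': "p' \<in> colored_perms l n"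
      and eq: "shift_perm l n p = shift_perm l n p'"
    have lt: "snd p i < l" "snd p' i < l" for i using p p' by (simp_all add: colored_perms_iff)
    have "cyc_dec n (fst p i) = cyc_dec n (fst p' i)" for i
      using eq by (simp add: shift_perm_def fun_eq_iff)
    then have 1: "fst p = fst p'"
      using permutes_inj[OF cyc_dec_permutes, of n] by (simp add: inj_eq fun_eq_iff)
    have eps: "snd (shift_perm l n p) i = snd (shift_perm l n p') i" for i
      using eq by simp
    have "snd p i = snd p' i" for i
    proof (cases "fst p i = 1")
      case True
      then have "(snd p i + 1) mod l = (snd p' i + 1) mod l"
        using eps[of i] 1 by (simp add: shift_perm_def)
      then show ?thesis using lt[of i]
        by (cases "snd p i + 1 = l"; cases "snd p' i + 1 = l") (simp_all add: mod_if split: if_splits)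
    next
      case False
      then show ?thesis
        using eps[of i] 1 by (simp add: shift_perm_def)
    qed
    with 1 show "p = p'" by (auto intro: prod_eqI)
  qed
  moreover have "shift_perm l n ` colored_perms l n \<subseteq> colored_perms l n"
    using shift_perm_in[OF assms] by blast
  ultimately show ?thesis
    using endo_inj_surj[OF finite_colored_perms] by (simp add: bij_betw_def)
qed

text \<open>The effect of replacing the least letter, at position i, by the greatest: the descent at
  i - 1 disappears and one at i appears. Both corrections are added, which avoids truncated
  subtraction; for i = 1 the term i - 1 is rightly 0.\<close>

lemma maj_upto_move:
  assumes "1 \<le> i" and "i \<le> n"
    and "\<And>p. 1 \<le> p \<Longrightarrow> p < n \<Longrightarrow> p \<noteq> i \<Longrightarrow> Suc p \<noteq> i \<Longrightarrow> D' p = D p"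
    and "i < n \<Longrightarrow> D' i" and "i < n \<Longrightarrow> \<not> D i"
    and "\<And>p. Suc p = i \<Longrightarrow> 1 \<le> p \<Longrightarrow> D p" and "\<And>p. Suc p = i \<Longrightarrow> 1 \<le> p \<Longrightarrow> \<not> D' p"
  shows "maj_upto D' n + (i - 1) = maj_upto D n + (if i < n then i else 0)"
proof -
  have "(\<Sum>p\<in>{1..<n}. (if D' p then p else 0) + (if p = i - 1 then p else 0)) =
      (\<Sum>p\<in>{1..<n}. (if D p then p else 0) + (if p = i then p else 0))"
  proof (rule sum.cong[OF refl])
    fix p assume "p \<in> {1..<n}"
    then have p: "1 \<le> p" "p < n" by auto
    consider "p = i" | "Suc p = i" | "p \<noteq> i" "Suc p \<noteq> i" by blast
    then show "(if D' p then p else 0) + (if p = i - 1 then p else 0) =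
      (if D p then p else 0) + (if p = i then p else 0)"
    proof cases
      case 1
      then show ?thesis using p assms(4,5) by auto
    next
      case 2
      then show ?thesis using p assms(6,7)[of p] by auto
    next
      case 3
      then show ?thesis using p assms(3)[of p] by auto
    qed
  qed
  moreover have "(\<Sum>p\<in>{1..<n}. if p = i - 1 then p else 0) = i - 1"
    using assms(1,2) by auto
  moreover have "(\<Sum>p\<in>{1..<n}. if p = i then p else 0) = (if i < n then i else 0)"
    using assms(1,2) by auto
  ultimately show ?thesis by (simp add: maj_upto_def sum.distrib)
qed

context
  fixes l n i0 :: nat and p :: "(nat \<Rightarrow> nat) \<times> (nat \<Rightarrow> nat)"
  assumes n: "1 \<le> n" and p: "p \<in> colored_perms l n" and i0: "fst p i0 = 1"
begin

private lemma p': "fst p permutes {1..n}" "\<And>i. snd p i < l" "\<And>i. i \<notin> {1..n} \<Longrightarrow> snd p i = 0"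
  using p by (auto simp: colored_perms_iff)

private lemma i0_in: "1 \<le> i0" "i0 \<le> n"
  using permutes_in_image[OF p'(1), of i0] i0 n by auto

private lemma p_eq_1: "fst p i = 1 \<longleftrightarrow> i = i0"
  using permutes_inj[OF p'(1)] i0 by (metis injD)

private lemma p_other:
  assumes "i \<in> {1..n}" "i \<noteq> i0"
  shows "2 \<le> fst p i" "fst p i \<le> n"
  using permutes_in_image[OF p'(1), of i] assms p_eq_1[of i] by auto

private lemma shift_i0: "fst (shift_perm l n p) i0 = n" "snd (shift_perm l n p) i0 = (snd p i0 + 1) mod l"
  using i0 n by (simp_all add: shift_perm_def cyc_dec_def)

private lemma shift_other:
  assumes "i \<in> {1..n}" "i \<noteq> i0"
  shows "fst (shift_perm l n p) i = fst p i - 1" "snd (shift_perm l n p) i = snd p i"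
  using p_other[OF assms] p_eq_1[of i] assms by (simp_all add: shift_perm_def cyc_dec_def)

private lemma mod_l: "(snd p i0 + 1) mod l = (if snd p i0 + 1 = l then 0 else snd p i0 + 1)"
  using p'(2)[of i0] by (auto simp: mod_if)

text \<open>The left side counts weak excedances of the image. Lowering v turns v > i into v - 1 >=
  i, and 1 of color l - 1 becomes n of color 0, which is always a weak excedance.\<close>

lemma shift_exc_fix:
  "cexc n (shift_perm l n p) + cfix n (shift_perm l n p) = cexc n p + (if snd p i0 + 1 = l then 1 else 0)"
proof -
  let ?s = "shift_perm l n p"
  have "cexc n ?s + cfix n ?s = card ({i \<in> {1..n}. snd ?s i = 0 \<and> i < fst ?s i} \<union> {i \<in> {1..n}. fst ?s i = i \<and> snd ?s i = 0})"
    unfolding cexc_def cfix_def by (subst card_Un_disjoint) auto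
  also have "{i \<in> {1..n}. snd ?s i = 0 \<and> i < fst ?s i} \<union> {i \<in> {1..n}. fst ?s i = i \<and> snd ?s i = 0} =
      {i \<in> {1..n}. snd ?s i = 0 \<and> i \<le> fst ?s i}" by auto
  also have "\<dots> = (if snd p i0 + 1 = l then {i0} else {}) \<union> {i \<in> {1..n}. snd p i = 0 \<and> i < fst p i}" (is "?L = ?R")
  proof (rule set_eqI)
    fix i
    show "i \<in> ?L \<longleftrightarrow> i \<in> ?R"
    proof (cases "i \<in> {1..n} \<and> i \<noteq> i0")
      case True
      then show ?thesis using p_other[of i] shift_other[of i] by auto
    next
      case False
      then show ?thesis using i0_in i0 shift_i0 mod_l by auto
    qed
  qed
  also have "card \<dots> = (if snd p i0 + 1 = l then 1 else 0) + cexc n p"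
    unfolding cexc_def by (subst card_Un_disjoint) (use i0 in auto)
  finally show ?thesis by simp
qed

text \<open>If the letter 1 has color l - 1, that color is lost but exc + fix gains one, worth l;
  otherwise its color rises by one. Either way the net change is 1.\<close>

lemma shift_fexc: "cfexc l n (shift_perm l n p) + l * cfix n (shift_perm l n p) = cfexc l n p + 1"
proof -
  let ?s = "shift_perm l n p"
  have i0n: "i0 \<in> {1..n}" using i0_in by simp
  have "(\<Sum>i\<in>{1..n} - {i0}. snd ?s i) = (\<Sum>i\<in>{1..n} - {i0}. snd p i)"
    by (rule sum.cong) (auto simp: shift_other)
  then have S: "(\<Sum>i=1..n. snd ?s i) + snd p i0 = (\<Sum>i=1..n. snd p i) + (snd p i0 + 1) mod l"
    unfolding sum.remove[OF finite_atLeastAtMost i0n, of "snd ?s"]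
      sum.remove[OF finite_atLeastAtMost i0n, of "snd p"] shift_i0 by simp
  have "cfexc l n ?s + l * cfix n ?s = l * (cexc n ?s + cfix n ?s) + (\<Sum>i=1..n. snd ?s i)"
    by (simp add: cfexc_def algebra_simps)
  also have "\<dots> = cfexc l n p + 1"
    using S mod_l unfolding shift_exc_fix by (auto simp: cfexc_def algebra_simps)
  finally show ?thesis .
qed

text \<open>The shift preserves all comparisons unless 1 of color l - 1, the least possible letter,
  wraps around to the greatest; then \<open>maj_upto_move\<close> applies at its position.\<close>

lemma shift_maj:
  "cmaj n (shift_perm l n p) + (if snd p i0 + 1 = l then i0 - 1 else 0) =
   cmaj n p + (if snd p i0 + 1 = l \<and> i0 < n then i0 else 0)"
proof -
  let ?s = "shift_perm l n p"
  have gen: "cdes ?s i = cdes p i" if "1 \<le> i" "i < n" "i \<noteq> i0" "Suc i \<noteq> i0" for i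
    using that p_other[of i] p_other[of "Suc i"] shift_other[of i] shift_other[of "Suc i"]
    by (auto simp: cdes_def col_less_def)
  show ?thesis
  proof (cases "snd p i0 + 1 = l")
    case True
    have "maj_upto (cdes ?s) n + (i0 - 1) = maj_upto (cdes p) n + (if i0 < n then i0 else 0)"
    proof (rule maj_upto_move[OF i0_in])
      show "cdes ?s i0" if "i0 < n"
        using True that shift_i0 mod_l i0_in p_other[of "Suc i0"] shift_other[of "Suc i0"]
        by (auto simp: cdes_def col_less_def)
      show "\<not> cdes p i0" if "i0 < n"
        using True that i0 i0_in p_other[of "Suc i0"] p'(2)[of "Suc i0"]
        by (auto simp: cdes_def col_less_def)
      fix i assume i: "Suc i = i0" "1 \<le> i"
      have o: "2 \<le> fst p i" "fst p i \<le> n" "fst ?s i = fst p i - 1" "snd ?s i = snd p i"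
        using p_other[of i] shift_other[of i] i i0_in by auto
      show "cdes p i" using True i o i0 p'(2)[of i] by (auto simp: cdes_def col_less_def)
      show "\<not> cdes ?s i" using True i o shift_i0 mod_l by (auto simp: cdes_def col_less_def)
    qed (rule gen)
    then show ?thesis using True by (simp add: cmaj_eq)
  next
    case False
    have "maj_upto (cdes ?s) n = maj_upto (cdes p) n"
    proof (rule maj_upto_cong)
      fix i assume i: "1 \<le> i" "i < n"
      consider "i = i0" | "Suc i = i0" | "i \<noteq> i0" "Suc i \<noteq> i0" by blast
      then show "cdes ?s i = cdes p i"
      proof cases
        case 1
        have "2 \<le> fst p (Suc i)" "fst p (Suc i) \<le> n" "fst ?s (Suc i) = fst p (Suc i) - 1" "snd ?s (Suc i) = snd p (Suc i)"
          using p_other[of "Suc i"] shift_other[of "Suc i"] i 1 by auto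
        then show ?thesis using 1 False i0 shift_i0 mod_l by (auto simp: cdes_def col_less_def)
      next
        case 2
        have "2 \<le> fst p i" "fst p i \<le> n" "fst ?s i = fst p i - 1" "snd ?s i = snd p i"
          using p_other[of i] shift_other[of i] i 2 by auto
        then show ?thesis using 2 False i0 shift_i0 mod_l by (auto simp: cdes_def col_less_def)
      qed (rule gen[OF i])
    qed
    then show ?thesis using False by (simp add: cmaj_eq)
  qed
qed

text \<open>Detects wrap-around at the last position from the image alone, as needed when the sum is
  reindexed by the shift.\<close>

lemma shift_last: "fst (shift_perm l n p) n = n \<and> snd (shift_perm l n p) n = 0 \<longleftrightarrow> i0 = n \<and> snd p i0 + 1 = l"
proof (cases "i0 = n")
  case True
  then show ?thesis using shift_i0 mod_l by auto
next
  case False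
  then show ?thesis using n p_other[of n] shift_other[of n] by auto
qed

end

text \<open>The weight in which weak excedances, exc + fix in number, replace excedances in both
  exponents.\<close>

definition wt_weak :: "nat \<Rightarrow> nat \<Rightarrow> (nat \<Rightarrow> nat) \<times> (nat \<Rightarrow> nat) \<Rightarrow> int fls poly" where
  "wt_weak l n p = tq_mono (cfexc l n p + l * cfix n p) (int (cmaj n p) - int (cexc n p) - int (cfix n p))"

text \<open>On wrap-around at i0 < n, maj and exc + fix of the image both exceed maj and exc of p by
  one. At i0 = n, maj drops by n - 1 instead, so the difference drops by n; this is the factor
  q^n.\<close>

lemma wt_shift:
  assumes n: "1 \<le> n" and p: "p \<in> colored_perms l n"
  shows "tq_mono 1 0 * wt_poly l n p =
    (if fst (shift_perm l n p) n = n \<and> snd (shift_perm l n p) n = 0 then tq_mono 0 (int n) else 1)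
      * wt_weak l n (shift_perm l n p)"
proof -
  have perm: "fst p permutes {1..n}" using p by (simp add: colored_perms_iff)
  then obtain i0 where i0: "fst p i0 = 1" using permutes_surj by (metis surjD)
  have "i0 \<in> {1..n}" using permutes_in_image[OF perm, of i0] i0 n by simp
  then have i0n: "1 \<le> i0" "i0 \<le> n" by auto
  note st = shift_exc_fix[OF n p i0] shift_fexc[OF n p i0] shift_maj[OF n p i0] shift_last[OF n p i0]
  define s where "s = shift_perm l n p"
  define c where "c \<longleftrightarrow> i0 = n \<and> snd p i0 + 1 = l"
  have "int (cmaj n p) - int (cexc n p) =
      (if c then int n else 0) + (int (cmaj n s) - int (cexc n s) - int (cfix n s))"
  proof (cases "snd p i0 + 1 = l")
    case True
    have "cexc n s + cfix n s = cexc n p + 1" "cmaj n s + (i0 - 1) = cmaj n p + (if i0 < n then i0 else 0)"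
      using st(1,3) True unfolding s_def by simp_all
    then show ?thesis using i0n True unfolding c_def by (cases "i0 = n") simp_all
  next
    case False
    have "cexc n s + cfix n s = cexc n p" "cmaj n s = cmaj n p"
      using st(1,3) False unfolding s_def by simp_all
    then show ?thesis using False unfolding c_def by simp
  qed
  moreover have "1 + cfexc l n p = cfexc l n s + l * cfix n s" using st(2) unfolding s_def by simp
  ultimately have "tq_mono 1 0 * wt_poly l n p = tq_mono (cfexc l n s + l * cfix n s)
      ((if c then int n else 0) + (int (cmaj n s) - int (cexc n s) - int (cfix n s)))"
    by (simp only: wt_poly_def tq_mono_mult add_0)
  also have "\<dots> = (if c then tq_mono 0 (int n) else 1) * wt_weak l n s"
    by (cases c) (simp_all only: if_True if_False wt_weak_def tq_mono_mult add_0 mult_1)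
  finally show ?thesis
    unfolding s_def[symmetric] st(4)[folded s_def c_def] .
qed

text \<open>An equality of sets and not merely a bijection, because the encoding continues a colored
  permutation by the identity with color 0.\<close>

lemma colored_perms_Suc_fixed:
  "{p \<in> colored_perms l (Suc k). fst p (Suc k) = Suc k \<and> snd p (Suc k) = 0} = colored_perms l k"
proof (intro equalityI subsetI)
  fix p assume p: "p \<in> {p \<in> colored_perms l (Suc k). fst p (Suc k) = Suc k \<and> snd p (Suc k) = 0}"
  then have "fst p permutes {1..Suc k}" by (simp add: colored_perms_iff)
  then have "fst p permutes {1..k}"
    by (rule permutes_superset) (use p in \<open>auto simp: le_Suc_eq\<close>)
  moreover have "snd p i = 0" if "i \<notin> {1..k}" for i
    using that p by (cases "i = Suc k") (auto simp: colored_perms_iff)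
  ultimately show "p \<in> colored_perms l k" using p by (simp add: colored_perms_iff)
next
  fix p assume p: "p \<in> colored_perms l k"
  then have p': "fst p permutes {1..k}" by (simp add: colored_perms_iff)
  have "fst p permutes {1..Suc k}" by (rule permutes_subset[OF p']) auto
  moreover have "fst p (Suc k) = Suc k" by (rule permutes_not_in[OF p']) simp
  ultimately show "p \<in> {p \<in> colored_perms l (Suc k). fst p (Suc k) = Suc k \<and> snd p (Suc k) = 0}"
    using p by (auto simp: colored_perms_iff)
qed

text \<open>The new last letter is the greatest, so it creates no descent; as a fixed point it
  contributes t^l q^(-1).\<close>

lemma wt_weak_Suc:
  assumes p: "p \<in> colored_perms l k"
  shows "wt_weak l (Suc k) p = tq_mono l (-1) * wt_weak l k p"
proof -
  have p': "fst p permutes {1..k}" "snd p (Suc k) = 0" using p by (simp_all add: colored_perms_iff)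
  have f: "fst p (Suc k) = Suc k" by (rule permutes_not_in[OF p'(1)]) simp
  have "{i \<in> {1..Suc k}. snd p i = 0 \<and> i < fst p i} = {i \<in> {1..k}. snd p i = 0 \<and> i < fst p i}"
    using f by (auto simp: le_Suc_eq)
  then have exc: "cexc (Suc k) p = cexc k p" by (simp add: cexc_def)
  have "{i \<in> {1..Suc k}. fst p i = i \<and> snd p i = 0} = insert (Suc k) {i \<in> {1..k}. fst p i = i \<and> snd p i = 0}"
    using f p'(2) by (auto simp: le_Suc_eq)
  then have fix_Suc: "cfix (Suc k) p = Suc (cfix k p)" by (simp add: cfix_def)
  have fexc: "cfexc l (Suc k) p = cfexc l k p" using p'(2) by (simp add: cfexc_def exc)
  have "\<not> cdes p k" if "0 < k"
    using permutes_in_image[OF p'(1), of k] that f p'(2) by (auto simp: cdes_def col_less_def)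
  then have "cmaj (Suc k) p = cmaj k p"
    by (cases "k = 0") (simp_all add: cmaj_eq maj_upto_Suc, simp add: maj_upto_def)
  then show ?thesis
    by (simp add: wt_weak_def exc fix_Suc fexc tq_mono_mult algebra_simps)
qed

definition weak_poly :: "nat \<Rightarrow> nat \<Rightarrow> int fls poly" where
  "weak_poly l n = (\<Sum>p\<in>colored_perms l n. wt_weak l n p)"

definition all_poly :: "nat \<Rightarrow> nat \<Rightarrow> int fls poly" where
  "all_poly l n = (\<Sum>p\<in>colored_perms l n. wt_poly l n p)"

text \<open>Writing q^n as 1 - (1 - q^n), with n = k + 1, separates the full weak sum from a
  correction over the permutations ending in a fixed n, which are those of k letters.\<close>

lemma shift_recurrence:
  "tq_mono 1 0 * all_poly l (Suc k) =
     weak_poly l (Suc k) - tq_mono l (-1) * (1 - tq_mono 0 1 ^ Suc k) * weak_poly l k"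
proof -
  let ?E = "\<lambda>p. fst p (Suc k) = Suc k \<and> snd p (Suc k) = 0"
  have pow: "tq_mono 0 1 ^ i = tq_mono 0 (int i)" for i
    by (simp add: tq_mono_power)
  have "tq_mono 1 0 * all_poly l (Suc k) =
      (\<Sum>p\<in>colored_perms l (Suc k). (\<lambda>s. (if ?E s then tq_mono 0 (int (Suc k)) else 1) * wt_weak l (Suc k) s) (shift_perm l (Suc k) p))"
    unfolding all_poly_def sum_distrib_left by (rule sum.cong) (simp_all only: wt_shift le_add1 Suc_eq_plus1_left)
  also have "\<dots> = (\<Sum>s\<in>colored_perms l (Suc k). (if ?E s then tq_mono 0 (int (Suc k)) else 1) * wt_weak l (Suc k) s)"
    by (rule sum.reindex_bij_betw[OF bij_shift_perm]) simp
  also have "\<dots> = (\<Sum>s\<in>colored_perms l (Suc k). wt_weak l (Suc k) s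
      - (if ?E s then (1 - tq_mono 0 (int (Suc k))) * wt_weak l (Suc k) s else 0))"
    by (rule sum.cong) (auto simp: algebra_simps)
  also have "\<dots> = weak_poly l (Suc k) -
      (\<Sum>s\<in>colored_perms l k. (1 - tq_mono 0 (int (Suc k))) * wt_weak l (Suc k) s)"
    unfolding sum_subtractf weak_poly_def
    by (subst sum.inter_filter[symmetric, OF finite_colored_perms]) (simp only: colored_perms_Suc_fixed)
  also have "(\<Sum>s\<in>colored_perms l k. (1 - tq_mono 0 (int (Suc k))) * wt_weak l (Suc k) s) =
      tq_mono l (-1) * (1 - tq_mono 0 1 ^ Suc k) * weak_poly l k"
    unfolding weak_poly_def sum_distrib_left
    by (rule sum.cong) (simp_all only: wt_weak_Suc pow mult_ac)
  finally show ?thesis .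
qed

subsection \<open>Recurrences\<close>

lemma cfix_le: "cfix n p \<le> n"
proof -
  have "cfix n p \<le> card {1..n}" unfolding cfix_def by (rule card_mono) auto
  then show ?thesis by simp
qed

lemma sum_by_cfix:
  "(\<Sum>p\<in>colored_perms l n. f (cfix n p) * wt_poly l n p) =
     (\<Sum>j\<le>n. f j * (qbinom (tq_mono 0 1) n j * fix_poly l (n - j) 0))"
proof -
  have "(\<Sum>p\<in>colored_perms l n. f (cfix n p) * wt_poly l n p) =
      (\<Sum>j\<le>n. \<Sum>p | p \<in> colored_perms l n \<and> cfix n p = j. f (cfix n p) * wt_poly l n p)"
    by (rule sum.group[symmetric]) (auto simp: finite_colored_perms cfix_le)
  also have "\<dots> = (\<Sum>j\<le>n. f j * fix_poly l n j)"
    unfolding fix_poly_def sum_distrib_left by (rule sum.cong[OF refl], rule sum.cong) auto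
  also have "\<dots> = (\<Sum>j\<le>n. f j * (qbinom (tq_mono 0 1) n j * fix_poly l (n - j) 0))"
    by (rule sum.cong[OF refl]) (subst fix_poly_eq, simp_all)
  finally show ?thesis .
qed

lemma all_poly_eq:
  "all_poly l n = (\<Sum>j\<le>n. qbinom (tq_mono 0 1) n j * fix_poly l (n - j) 0)"
  using sum_by_cfix[of "\<lambda>_. 1"] by (simp add: all_poly_def)

lemma weak_poly_eq:
  "weak_poly l n = (\<Sum>j\<le>n. tq_mono l (-1) ^ j * (qbinom (tq_mono 0 1) n j * fix_poly l (n - j) 0))"
proof -
  have "wt_weak l n p = tq_mono l (-1) ^ cfix n p * wt_poly l n p" for p
    by (simp add: wt_weak_def wt_poly_def tq_mono_power tq_mono_mult algebra_simps)
  then show ?thesis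
    using sum_by_cfix[of "\<lambda>j. tq_mono l (-1) ^ j"] by (simp add: weak_poly_def)
qed

lemma tq_mono_1_power: "tq_mono 1 0 ^ i = tq_mono i 0"
  by (simp add: tq_mono_power)

lemma fix_poly_relation:
  assumes "1 \<le> n"
  shows "(\<Sum>j\<le>n. (tq_mono 1 0 ^ (l * j) - tq_mono 1 0) * (qbinom (tq_mono 0 1) n j * fix_poly l (n - j) 0)) = 0"
proof -
  obtain k where n: "n = Suc k" using assms by (cases n) auto
  define q T x where "q = tq_mono 0 1" and "T = tq_mono 1 0" and "x = tq_mono l (-1)"
  define d where "d m = fix_poly l m 0" for m
  have xq: "x ^ j * q ^ j = T ^ (l * j)" for j
    by (simp add: x_def q_def T_def tq_mono_power tq_mono_mult mult.commute)
  have "x * (1 - q ^ Suc k) * weak_poly l k =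
      (\<Sum>j\<le>k. x ^ Suc j * ((1 - q ^ Suc k) * qbinom q k j) * d (k - j))"
    unfolding weak_poly_eq sum_distrib_left x_def[symmetric] q_def[symmetric] d_def[symmetric]
    by (rule sum.cong) (simp_all add: algebra_simps)
  \<comment> \<open>Absorption. Afterwards the index moves up by one; the added term for j = 0
    vanishes because of 1 - q^0.\<close>
  also have "\<dots> = (\<Sum>j\<le>k. x ^ Suc j * (1 - q ^ Suc j) * (qbinom q (Suc k) (Suc j) * d (Suc k - Suc j)))"
    unfolding qbinom_absorb[symmetric] by (rule sum.cong) (simp_all only: mult.assoc diff_Suc_Suc)
  also have "\<dots> = (\<Sum>j\<le>Suc k. x ^ j * (1 - q ^ j) * (qbinom q (Suc k) j * d (Suc k - j)))"
    by (subst sum.atMost_Suc_shift) simp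
  finally have "weak_poly l (Suc k) - x * (1 - q ^ Suc k) * weak_poly l k =
      (\<Sum>j\<le>Suc k. x ^ j * (qbinom q (Suc k) j * d (Suc k - j))) -
      (\<Sum>j\<le>Suc k. x ^ j * (1 - q ^ j) * (qbinom q (Suc k) j * d (Suc k - j)))"
    unfolding weak_poly_eq x_def[symmetric] q_def[symmetric] d_def[symmetric] by simp
  also have "\<dots> = (\<Sum>j\<le>Suc k. T ^ (l * j) * (qbinom q (Suc k) j * d (Suc k - j)))"
    unfolding sum_subtractf[symmetric] xq[symmetric]
    by (rule sum.cong) (simp_all only: right_diff_distrib left_diff_distrib mult_1_right diff_diff_eq2 add_diff_cancel_left')
  finally have "T * all_poly l (Suc k) = (\<Sum>j\<le>Suc k. T ^ (l * j) * (qbinom q (Suc k) j * d (Suc k - j)))"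
    using shift_recurrence[of l k] by (simp only: x_def q_def T_def)
  moreover have "T * all_poly l (Suc k) = (\<Sum>j\<le>Suc k. T * (qbinom q (Suc k) j * d (Suc k - j)))"
    unfolding all_poly_eq sum_distrib_left q_def d_def ..
  ultimately show ?thesis
    unfolding n T_def[symmetric] q_def[symmetric] d_def[symmetric] left_diff_distrib sum_subtractf by simp
qed

lemma one_minus_t_neq_0: "1 - tq_mono 1 0 \<noteq> 0"
proof
  assume "1 - tq_mono 1 0 = 0"
  then have "tq_mono 1 0 = tq_mono 0 0" by (simp add: tq_mono_0)
  then have "coeff (tq_mono 1 0) 1 = coeff (tq_mono 0 0) 1" by simp
  then show False by (simp add: tq_mono_def)
qed

lemma fix_poly_rec:
  assumes "1 \<le> n" and l: "1 \<le> l"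
  shows "fix_poly l n 0 = (\<Sum>j=1..n. qbinom (tq_mono 0 1) n j *
    (tq_mono 1 0 * ((\<Sum>i<l * j - 1. tq_mono 1 0 ^ i) * fix_poly l (n - j) 0)))"
proof -
  define T where "T = tq_mono 1 0"
  define f where "f j = qbinom (tq_mono 0 1) n j * fix_poly l (n - j) 0" for j
  have split: "{..n} = insert 0 {1..n}" by auto
  have "(1 - T) * f 0 + (\<Sum>j=1..n. (T ^ (l * j) - T) * f j) = 0"
    using fix_poly_relation[OF assms(1), of l] unfolding split f_def[symmetric] T_def[symmetric] by simp
  then have "(1 - T) * f 0 = - (\<Sum>j=1..n. (T ^ (l * j) - T) * f j)"
    by (simp only: eq_neg_iff_add_eq_0)
  moreover have "(\<Sum>j=1..n. (T - T ^ (l * j)) * f j) = - (\<Sum>j=1..n. (T ^ (l * j) - T) * f j)"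
    unfolding sum_negf[symmetric] by (rule sum.cong) (simp_all add: algebra_simps)
  ultimately have "(1 - T) * f 0 = (\<Sum>j=1..n. (T - T ^ (l * j)) * f j)"
    by simp
  also have "\<dots> = (\<Sum>j=1..n. (1 - T) * (T * (\<Sum>i<l * j - 1. T ^ i) * f j))"
  proof (rule sum.cong[OF refl])
    fix j assume "j \<in> {1..n}"
    \<comment> \<open>Positivity of l and j keeps the truncated difference l * j - 1 exact.\<close>
    then have "l * j = Suc (l * j - 1)" using l by simp
    then have "T - T ^ (l * j) = T * (1 - T ^ (l * j - 1))"
      by (metis power_Suc right_diff_distrib mult_1_right)
    also have "\<dots> = (1 - T) * (T * (\<Sum>i<l * j - 1. T ^ i))"
      by (simp add: one_diff_power_eq)
    finally show "(T - T ^ (l * j)) * f j = (1 - T) * (T * (\<Sum>i<l * j - 1. T ^ i) * f j)"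
      by simp
  qed
  also have "\<dots> = (1 - T) * (\<Sum>j=1..n. T * (\<Sum>i<l * j - 1. T ^ i) * f j)"
    by (simp only: sum_distrib_left)
  finally have "f 0 = (\<Sum>j=1..n. T * (\<Sum>i<l * j - 1. T ^ i) * f j)"
    using one_minus_t_neq_0 by (simp add: T_def)
  also have "\<dots> = (\<Sum>j=1..n. qbinom (tq_mono 0 1) n j * (T * ((\<Sum>i<l * j - 1. T ^ i) * fix_poly l (n - j) 0)))"
    unfolding f_def by (rule sum.cong) (simp_all only: mult_ac)
  finally show ?thesis by (simp add: f_def T_def)
qed

lemma all_poly_rec:
  assumes "1 \<le> n"
  shows "all_poly l n = (\<Sum>j=1..n. qbinom (tq_mono 0 1) n j *
    ((\<Sum>i<l * j. tq_mono 1 0 ^ i) * fix_poly l (n - j) 0))"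
proof -
  define T where "T = tq_mono 1 0"
  define f where "f j = qbinom (tq_mono 0 1) n j * fix_poly l (n - j) 0" for j
  have split: "{..n} = insert 0 {1..n}" by auto
  \<comment> \<open>The subtracted sum is 0 by \<open>fix_poly_relation\<close>. It is inserted to
    turn 1 - t into 1 - t^(lj), which removes j = 0 and hence d(n) itself.\<close>
  have "(1 - T) * all_poly l n = (\<Sum>j\<le>n. (1 - T) * f j) - (\<Sum>j\<le>n. (T ^ (l * j) - T) * f j)"
    using fix_poly_relation[OF assms, of l]
    by (simp add: all_poly_eq f_def T_def sum_distrib_left)
  also have "\<dots> = (\<Sum>j\<le>n. (1 - T ^ (l * j)) * f j)"
    unfolding sum_subtractf[symmetric] left_diff_distrib by simp
  also have "\<dots> = (\<Sum>j=1..n. (1 - T ^ (l * j)) * f j)"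
    unfolding split by simp
  also have "\<dots> = (1 - T) * (\<Sum>j=1..n. (\<Sum>i<l * j. T ^ i) * f j)"
    unfolding sum_distrib_left[of "1 - T"] by (rule sum.cong) (simp_all only: one_diff_power_eq mult.assoc)
  finally have "all_poly l n = (\<Sum>j=1..n. (\<Sum>i<l * j. T ^ i) * f j)"
    using one_minus_t_neq_0 by (simp add: T_def)
  then show ?thesis
    unfolding f_def T_def by (simp only: mult_ac)
qed

subsection \<open>Symmetric unimodal polynomials\<close>

text \<open>The zero polynomial is included, for every center c / 2.\<close>

definition sym_uni :: "nat \<Rightarrow> int fls poly \<Rightarrow> bool" where
  "sym_uni c P \<longleftrightarrow> (\<forall>i k. 0 \<le> fls_nth (coeff P i) k) \<and> (\<forall>i>c. coeff P i = 0) \<and>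
     (\<forall>i\<le>c. coeff P (c - i) = coeff P i) \<and>
     (\<forall>i k. 2 * i < c \<longrightarrow> fls_nth (coeff P i) k \<le> fls_nth (coeff P (Suc i)) k)"

lemma sym_uniI:
  assumes "\<And>i k. 0 \<le> fls_nth (coeff P i) k" "\<And>i. c < i \<Longrightarrow> coeff P i = 0"
    "\<And>i. i \<le> c \<Longrightarrow> coeff P (c - i) = coeff P i"
    "\<And>i k. 2 * i < c \<Longrightarrow> fls_nth (coeff P i) k \<le> fls_nth (coeff P (Suc i)) k"
  shows "sym_uni c P"
  using assms by (simp add: sym_uni_def)

lemma sym_uniD:
  assumes "sym_uni c P"
  shows "0 \<le> fls_nth (coeff P i) k" "c < i \<Longrightarrow> coeff P i = 0"
    "i \<le> c \<Longrightarrow> coeff P (c - i) = coeff P i"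
    "2 * i < c \<Longrightarrow> fls_nth (coeff P i) k \<le> fls_nth (coeff P (Suc i)) k"
  using assms by (simp_all add: sym_uni_def)

lemma sym_uni_0 [simp]: "sym_uni c 0"
  by (simp add: sym_uni_def)

text \<open>Closure under sums is the reason for making the center a parameter: summands with the
  same center may have different supports.\<close>

lemma sym_uni_add: "sym_uni c P \<Longrightarrow> sym_uni c Q \<Longrightarrow> sym_uni c (P + Q)"
  by (auto simp: sym_uni_def add_mono)

lemma sym_uni_sum: "(\<And>x. x \<in> S \<Longrightarrow> sym_uni c (f x)) \<Longrightarrow> sym_uni c (sum f S)"
  by (induction S rule: infinite_finite_induct) (auto intro: sym_uni_add)

lemma sym_uni_tq_mono_0: "sym_uni c P \<Longrightarrow> sym_uni c (tq_mono 0 k * P)"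
  by (auto simp: sym_uni_def tq_mono_def coeff_monom_mult fls_X_intpow_times_conv_shift)

text \<open>By q-Pascal the q-binomial is a sum of powers of q, and each of these merely shifts the
  coefficients of P in q.\<close>

lemma sym_uni_qbinom: "sym_uni c P \<Longrightarrow> sym_uni c (qbinom (tq_mono 0 1) n k * P)"
proof (induction n arbitrary: k)
  case 0
  then show ?case by (cases k) auto
next
  case (Suc n)
  show ?case
  proof (cases k)
    case 0
    then show ?thesis using Suc.prems by simp
  next
    case (Suc i)
    have "qbinom (tq_mono 0 1) (Suc n) k * P = qbinom (tq_mono 0 1) n i * P
        + tq_mono 0 (int k) * (qbinom (tq_mono 0 1) n k * P)"
      using Suc tq_mono_power[of 0 1 k] by (simp add: algebra_simps)
    then show ?thesis using Suc.IH Suc.prems by (simp add: sym_uni_add sym_uni_tq_mono_0)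
  qed
qed

lemma coeff_t_power_mult:
  "coeff (tq_mono 1 0 ^ s * P) i = (if s \<le> i then coeff P (i - s) else 0)"
  unfolding tq_mono_1_power by (simp add: tq_mono_def coeff_monom_mult)

text \<open>The parameter c is twice the center, hence c + 2. Nonnegativity supplies the first
  increase, from the new constant coefficient 0.\<close>

lemma sym_uni_t: "sym_uni c P \<Longrightarrow> sym_uni (c + 2) (tq_mono 1 0 * P)"
proof (rule sym_uniI)
  assume P: "sym_uni c P"
  have co: "coeff (tq_mono 1 0 * P) i = (case i of 0 \<Rightarrow> 0 | Suc i \<Rightarrow> coeff P i)" for i
    using coeff_t_power_mult[of 1 P i] by (simp split: nat.split)
  show "0 \<le> fls_nth (coeff (tq_mono 1 0 * P) i) k" for i k
    unfolding co using sym_uniD(1)[OF P] by (simp split: nat.split)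
  show "coeff (tq_mono 1 0 * P) i = 0" if "c + 2 < i" for i
    unfolding co using sym_uniD(2)[OF P] that by (simp split: nat.split)
  show "coeff (tq_mono 1 0 * P) (c + 2 - i) = coeff (tq_mono 1 0 * P) i" if "i \<le> c + 2" for i
  proof -
    note i = that
    consider "i = 0" | "i = c + 2" | k where "i = Suc k" "k \<le> c"
    proof (cases i)
      case (Suc k)
      then show ?thesis using that i by (cases "k = c + 1") auto
    qed (rule that)
    then show ?thesis
    proof cases
      case 3
      then have "c + 2 - i = Suc (c - k)" by simp
      then show ?thesis unfolding co using 3 sym_uniD(3)[OF P, of k] by simp
    qed (use sym_uniD(2)[OF P, of "Suc c"] in \<open>simp_all only: co, simp_all\<close>)
  qed
  show "fls_nth (coeff (tq_mono 1 0 * P) i) k \<le> fls_nth (coeff (tq_mono 1 0 * P) (Suc i)) k"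
    if "2 * i < c + 2" for i k
    unfolding co using that sym_uniD(1,4)[OF P] by (simp split: nat.split)
qed

text \<open>The coefficients of the product Q are sums over a sliding window, so Q_(i+1) - Q_i =
  P_(i+1) - P_(i-b). For 2i < c + b the index i + 1 is at least as close to the center c/2 as i - b,
  which makes the difference nonnegative.\<close>

lemma sym_uni_block:
  assumes P: "sym_uni c P"
  shows "sym_uni (c + b) ((\<Sum>s<Suc b. tq_mono 1 0 ^ s) * P)"
proof (rule sym_uniI)
  let ?Q = "(\<Sum>s<Suc b. tq_mono 1 0 ^ s) * P"
  let ?g = "\<lambda>i s. if s \<le> i then coeff P (i - s) else 0"
  have co: "coeff ?Q i = (\<Sum>s<Suc b. ?g i s)" for i
    unfolding sum_distrib_right coeff_sum coeff_t_power_mult ..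
  have conth: "fls_nth (sum f S) k = (\<Sum>s\<in>S. fls_nth (f s) k)" for f :: "nat \<Rightarrow> int fls" and S k
    by (induction S rule: infinite_finite_induct) auto
  show "0 \<le> fls_nth (coeff ?Q i) k" for i k
    unfolding co conth using sym_uniD(1)[OF P] by (intro sum_nonneg) simp
  show "coeff ?Q i = 0" if "c + b < i" for i
    unfolding co using sym_uniD(2)[OF P] that by (intro sum.neutral) auto
  show "coeff ?Q (c + b - i) = coeff ?Q i" if i: "i \<le> c + b" for i
  proof -
    \<comment> \<open>Reversing the window, s to b - s, matches the summands of the two coefficients
      one by one.\<close>
    have "coeff ?Q (c + b - i) = (\<Sum>s<Suc b. ?g (c + b - i) (Suc b - Suc s))"
      unfolding co by (rule sum.nat_diff_reindex[symmetric])
    also have "\<dots> = (\<Sum>s<Suc b. ?g i s)"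
    proof (rule sum.cong[OF refl])
      fix s assume "s \<in> {..<Suc b}"
      then have s: "s \<le> b" by simp
      consider "i < s" | "s \<le> i" "i - s \<le> c" | "s \<le> i" "c < i - s" by linarith
      then show "?g (c + b - i) (Suc b - Suc s) = ?g i s"
      proof cases
        case 1
        then show ?thesis using s i sym_uniD(2)[OF P, of "c + b - i - (Suc b - Suc s)"] by auto
      next
        case 2
        then have "c + b - i - (Suc b - Suc s) = c - (i - s)" "Suc b - Suc s \<le> c + b - i" using s i by auto
        then show ?thesis using 2 sym_uniD(3)[OF P 2(2)] by simp
      next
        case 3
        then have "\<not> Suc b - Suc s \<le> c + b - i" using s i by auto
        then show ?thesis using 3 sym_uniD(2)[OF P, of "i - s"] by simp
      qed
    qed
    finally show ?thesis unfolding co .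
  qed
  show "fls_nth (coeff ?Q i) k \<le> fls_nth (coeff ?Q (Suc i)) k" if i: "2 * i < c + b" for i k
  proof -
    \<comment> \<open>The window identity without subtraction; the leaving term
      \<open>?g i b\<close> is 0 as long as i < b.\<close>
    have "coeff ?Q (Suc i) + ?g i b = coeff P (Suc i) + coeff ?Q i"
    proof -
      have "?g (Suc i) (Suc s) = ?g i s" for s by (cases "s \<le> i") simp_all
      then show ?thesis
        unfolding co sum.lessThan_Suc_shift[of "?g (Suc i)"] sum.lessThan_Suc[of "?g i"] by simp
    qed
    then have "fls_nth (coeff ?Q (Suc i)) k + fls_nth (?g i b) k = fls_nth (coeff P (Suc i)) k + fls_nth (coeff ?Q i) k"
      by (metis fls_plus_nth)
    moreover have "fls_nth (?g i b) k \<le> fls_nth (coeff P (Suc i)) k"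
    proof (cases "b \<le> i")
      case False
      then show ?thesis using sym_uniD(1)[OF P] by simp
    next
      case True
      have mono: "fls_nth (coeff P u) k \<le> fls_nth (coeff P v) k" if "u \<le> v" "2 * v \<le> c + 1" for u v
        using that
      proof (induction v rule: dec_induct)
        case (step v)
        then show ?case using sym_uniD(4)[OF P, of v k] by simp
      qed simp
      show ?thesis
      proof (cases "2 * Suc i \<le> c + 1")
        case T: True
        then show ?thesis using mono[of "i - b" "Suc i"] True by simp
      next
        case F: False
        show ?thesis
        proof (cases "Suc i \<le> c")
          case True
          \<comment> \<open>Past the middle, i + 1 is reflected to c - (i + 1), and 2 * i < c + b
            places i - b at or below it.\<close>
          have "fls_nth (coeff P (i - b)) k \<le> fls_nth (coeff P (c - Suc i)) k"
            using F True i \<open>b \<le> i\<close> by (intro mono) auto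
          then show ?thesis using sym_uniD(3)[OF P True] \<open>b \<le> i\<close> by simp
        next
          case False
          then show ?thesis using i True by simp
        qed
      qed
    qed
    ultimately show ?thesis by simp
  qed
qed

section \<open>Symmetry and unimodality of the generating polynomials\<close>

lemma colored_perms_0: "1 \<le> l \<Longrightarrow> colored_perms l 0 = {(id, \<lambda>_. 0)}"
  by (auto simp: colored_perms_def)

text \<open>A block of lj - 1 powers of t has degree lj - 2 and the factor t adds 2, so every
  summand of the recurrence moves from l (n - j) to the common value l n.\<close>

lemma sym_uni_derangements:
  assumes l: "1 \<le> l"
  shows "sym_uni (l * n) (fix_poly l n 0)"
proof (induction n rule: less_induct)
  case (less n)
  show ?case
  proof (cases "n = 0")
    case True
    have "{p. p \<in> colored_perms l 0 \<and> cfix 0 p = 0} = {(id, \<lambda>_. 0)}"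
      unfolding colored_perms_0[OF l] by (auto simp: cfix_def)
    then have "fix_poly l 0 0 = 1"
      by (simp add: fix_poly_def wt_poly_def cfexc_def cexc_def cmaj_def tq_mono_0)
    moreover have "sym_uni 0 1" by (auto simp: sym_uni_def)
    ultimately show ?thesis using True by simp
  next
    case False
    then have n: "1 \<le> n" by simp
    have "sym_uni (l * n) (tq_mono 1 0 * ((\<Sum>i<l * j - 1. tq_mono 1 0 ^ i) * fix_poly l (n - j) 0))"
      if j: "j \<in> {1..n}" for j
    proof (cases "l * j - 1")
      \<comment> \<open>The block is empty only for l = j = 1; the summand is then the zero
        polynomial.\<close>
      case 0
      then show ?thesis by simp
    next
      case (Suc b)
      have "sym_uni (l * (n - j) + b + 2) (tq_mono 1 0 * ((\<Sum>i<Suc b. tq_mono 1 0 ^ i) * fix_poly l (n - j) 0))"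
        using j by (intro sym_uni_t sym_uni_block less.IH) auto
      moreover have "l * (n - j) + b + 2 = l * n"
      proof -
        have "l * (n - j) + l * j = l * n" using j by (simp flip: distrib_left)
        then show ?thesis using Suc by simp
      qed
      ultimately show ?thesis unfolding Suc by simp
    qed
    then show ?thesis
      unfolding fix_poly_rec[OF n l] by (intro sym_uni_sum sym_uni_qbinom)
  qed
qed

lemma sym_uni_fix_poly:
  assumes "1 \<le> l" and "j \<le> n"
  shows "sym_uni (l * (n - j)) (fix_poly l n j)"
  unfolding fix_poly_eq[OF assms(2)] by (intro sym_uni_qbinom sym_uni_derangements assms)

lemma sym_uni_all_poly:
  assumes l: "1 \<le> l" and n: "1 \<le> n"
  shows "sym_uni (l * n - 1) (all_poly l n)"
  unfolding all_poly_rec[OF n]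
proof (intro sym_uni_sum sym_uni_qbinom)
  fix j assume j: "j \<in> {1..n}"
  then have "l * j \<noteq> 0" using l by simp
  then obtain b where b: "l * j = Suc b" using not0_implies_Suc by blast
  have "l * j + l * (n - j) = l * n" using j by (simp flip: distrib_left)
  then have "l * (n - j) + b = l * n - 1" using b by simp
  then show "sym_uni (l * n - 1) ((\<Sum>i<l * j. tq_mono 1 0 ^ i) * fix_poly l (n - j) 0)"
    using sym_uni_block[OF sym_uni_derangements[OF l, of "n - j"], of b] b by simp
qed

section \<open>Return to coefficient functions\<close>

lemma coeff_wt_poly_sum:
  assumes "finite S"
  shows "fls_nth (coeff (\<Sum>p\<in>S. wt_poly l n p) i) k =
    int (card {p \<in> S. cfexc l n p = i \<and> int (cmaj n p) - int (cexc n p) = k})"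
proof -
  have "fls_nth (coeff (wt_poly l n p) i) k =
      (if cfexc l n p = i \<and> int (cmaj n p) - int (cexc n p) = k then 1 else 0)" for p
    by (auto simp: wt_poly_def tq_mono_def)
  moreover have "fls_nth (coeff (\<Sum>p\<in>S. wt_poly l n p) i) k = (\<Sum>p\<in>S. fls_nth (coeff (wt_poly l n p) i) k)"
    by (induction S rule: infinite_finite_induct) auto
  ultimately show ?thesis
    using assms by (simp add: sum.If_cases Int_def)
qed

lemma fix_coeff_eq: "fix_coeff l n j i = fls_nth (coeff (fix_poly l n j) i)"
proof
  fix k
  show "fix_coeff l n j i k = fls_nth (coeff (fix_poly l n j) i) k"
    unfolding fix_poly_def fix_coeff_def
    by (subst coeff_wt_poly_sum) (auto simp: finite_colored_perms intro!: arg_cong[where f = card])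
qed

lemma A_coeff_eq: "A_coeff l n i = fls_nth (coeff (all_poly l n) i)"
  by (rule ext) (simp add: all_poly_def A_coeff_def coeff_wt_poly_sum finite_colored_perms)

text \<open>The support may be smaller than {0..c}, but i to c - i maps it onto itself, so its least
  and greatest elements add up to c. The descending half is the ascending one reflected.\<close>

lemma symmetric_unimodal:
  assumes a: "\<And>i. a i = fls_nth (coeff P i)" and P: "sym_uni c P" and ne: "a i0 k0 \<noteq> 0"
  shows "t_symmetric_center a (real c / 2)" "t_unimodal a"
proof -
  define S where "S = t_support a"
  have sym: "a (c - i) = a i" if "i \<le> c" for i using sym_uniD(3)[OF P that] by (simp add: a)
  have le: "i \<le> c" if "i \<in> S" for i
    using that sym_uniD(2)[OF P, of i] by (force simp: S_def t_support_def a fun_eq_iff)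
  have S: "S \<noteq> {}" using ne by (auto simp: S_def t_support_def fun_eq_iff)
  have fin: "finite S" using le finite_nat_set_iff_bounded_le by blast
  have refl: "c - i \<in> S" if "i \<in> S" for i
    using that sym[OF le[OF that]] by (simp add: S_def t_support_def)
  define r s where "r = Min S" and "s = Max S"
  have r: "r \<in> S" "\<And>i. i \<in> S \<Longrightarrow> r \<le> i" using S fin by (auto simp: r_def)
  have s: "s = c - r"
    unfolding s_def
  proof (rule Max_eqI[OF fin])
    show "c - r \<in> S" by (rule refl[OF r(1)])
    fix i assume i: "i \<in> S"
    show "i \<le> c - r" using r(2)[OF refl[OF i]] le[OF i] le[OF r(1)] by linarith
  qed
  have rs: "r + s = c" using s le[OF r(1)] by simp
  have "a (r + k) = a (s - k)" if "k \<le> s - r" for k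
  proof -
    have "r + k \<le> c" "s - k = c - (r + k)" using that rs r(2)[of s] by auto
    then show ?thesis using sym by simp
  qed
  moreover have "real c / 2 = (real r + real s) / 2" using rs by (simp flip: of_nat_add)
  ultimately show "t_symmetric_center a (real c / 2)"
    using S fin by (simp add: t_symmetric_center_def Let_def flip: S_def r_def s_def)
  have up: "q_le (a i) (a (i + 1))" if "2 * i < c" for i
    using sym_uniD(4)[OF P that] by (simp add: a q_le_def)
  have "q_le (a (i + 1)) (a i)" if "(r + s + 1) div 2 \<le> i" "i < s" for i
  proof -
    have i: "i + 1 \<le> c" "2 * (c - (i + 1)) < c" "c - (i + 1) + 1 = c - i" using that rs by auto
    show ?thesis using up[OF i(2)] sym[OF i(1)] sym[of i] i(1,3) by simp
  qed
  then show "t_unimodal a"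
    using S fin up rs by (auto simp: t_unimodal_def Let_def simp flip: S_def r_def s_def)
qed

text \<open>Nonzero polynomials are required for symmetry and unimodality. The witness spoils the
  first n - j positions by color 1 or, for l = 1, by a cycle. No ordinary permutation has exactly n
  - 1 fixed points, so the case l = 1, j = n - 1 is excluded.\<close>

lemma exists_colored_perm_cfix:
  assumes "1 \<le> l" "j \<le> n" and "l \<ge> 2 \<or> j \<noteq> n - 1" "1 \<le> n"
  shows "\<exists>p\<in>colored_perms l n. cfix n p = j"
proof (cases "2 \<le> l")
  case True
  let ?p = "(id, \<lambda>i. if i \<in> {1..n - j} then 1 else 0) :: (nat \<Rightarrow> nat) \<times> (nat \<Rightarrow> nat)"
  have "{i \<in> {1..n}. fst ?p i = i \<and> snd ?p i = 0} = {n - j + 1..n}" by auto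
  then have "cfix n ?p = j" using assms(2) by (simp add: cfix_def)
  moreover have "?p \<in> colored_perms l n" using True assms(2) by (auto simp: colored_perms_def)
  ultimately show ?thesis by blast
next
  case False
  then have m: "n - j \<noteq> 1" using assms by auto
  let ?p = "(cyc_dec (n - j), \<lambda>i. 0)"
  have "{i \<in> {1..n}. fst ?p i = i \<and> snd ?p i = 0} = {n - j + 1..n}"
    using m by (auto simp: cyc_dec_def split: if_splits)
  then have "cfix n ?p = j" using assms(2) by (simp add: cfix_def)
  moreover have "cyc_dec (n - j) permutes {1..n}"
    by (rule permutes_subset[OF cyc_dec_permutes]) auto
  then have "?p \<in> colored_perms l n" using assms(1) by (auto simp: colored_perms_def)
  ultimately show ?thesis by blast
qed

theorem theorem4p12:
  fixes l n j :: nat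
  assumes "l \<ge> 1" and "n \<ge> 1" and "j \<le> n"
  shows "((l \<ge> 2 \<or> j \<noteq> n - 1) \<longrightarrow>
            t_symmetric_center (fix_coeff l n j) (real (l * (n - j)) / 2) \<and>
            t_unimodal (fix_coeff l n j)) \<and>
         t_symmetric_center (A_coeff l n) ((real (l * n) - 1) / 2) \<and>
         t_unimodal (A_coeff l n)"
proof (intro conjI impI)
  assume "l \<ge> 2 \<or> j \<noteq> n - 1"
  then obtain p where p: "p \<in> colored_perms l n" "cfix n p = j"
    using exists_colored_perm_cfix assms by blast
  then have "{p' \<in> colored_perms l n. cfix n p' = j \<and> cfexc l n p' = cfexc l n p \<and>
      int (cmaj n p') - int (cexc n p') = int (cmaj n p) - int (cexc n p)} \<noteq> {}" by blast
  then have "fix_coeff l n j (cfexc l n p) (int (cmaj n p) - int (cexc n p)) \<noteq> 0"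
    by (simp add: fix_coeff_def finite_colored_perms del: Collect_empty_eq)
  from symmetric_unimodal[OF fix_coeff_eq sym_uni_fix_poly[OF assms(1,3)] this]
  show "t_symmetric_center (fix_coeff l n j) (real (l * (n - j)) / 2)" "t_unimodal (fix_coeff l n j)" .
next
  \<comment> \<open>Any colored permutation would do; j = n avoids the excluded value n - 1.\<close>
  obtain p where p: "p \<in> colored_perms l n"
    using exists_colored_perm_cfix[of l n n] assms(1,2) by fastforce
  then have "{p' \<in> colored_perms l n. cfexc l n p' = cfexc l n p \<and>
      int (cmaj n p') - int (cexc n p') = int (cmaj n p) - int (cexc n p)} \<noteq> {}" by blast
  then have "A_coeff l n (cfexc l n p) (int (cmaj n p) - int (cexc n p)) \<noteq> 0"
    by (simp add: A_coeff_def finite_colored_perms del: Collect_empty_eq)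
  note * = symmetric_unimodal[OF A_coeff_eq sym_uni_all_poly[OF assms(1,2)] this]
  have "l * n \<ge> 1" using assms by simp
  then have "real (l * n - 1) = real (l * n) - 1" by simp
  then show "t_symmetric_center (A_coeff l n) ((real (l * n) - 1) / 2)" using *(1) by simp
  show "t_unimodal (A_coeff l n)" by (rule *(2))
qed

end
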